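(* Let $Q\in[0,1]$, $\eta\in\mathbb{D}$, and consider the symmetric restricted attack parameters $q_0=q_1=\sqrt{1-Q}$, $\eta_0=\eta$, $\eta_1=-\overline{\eta}$, with $\ket{e}=\eta\ket0_E+\sqrt{1-|\eta|^2}\ket1_E$, $\ket{f}=-\overline{\eta}\ket0_E+\sqrt{1-|\eta|^2}\ket1_E$. Define the isometry $\mathbf{Rw}$ on $\mathrm{span}\{\ket{00},\ket{11}\}\subseteq\mathcal{H}_{A_1A_2}$ by $\mathbf{Rw}\ket{00}=\sqrt{1-Q}\ket{0}\ket{0}\ket{0}_E+\sqrt{Q}\ket{1}\ket{0}\ket{f}$ and $\mathbf{Rw}\ket{11}=\sqrt{Q}\ket{0}\ket{1}\ket{e}+\sqrt{1-Q}\ket{1}\ket{1}\ket{0}_E$ (order $A_1A_2E$). Let $V$ be a unitary on $\mathcal{H}_{A_2}\otimes\mathcal{H}_E$ and define vectors $\ket{e_i},\ket{f_i}\in\mathcal{H}_E$ ($i=0,\dots,3$) by $V\ket{0}\ket{0}_E=\ket0\ket{e_0}+\ket1\ket{e_1}$, $V\ket1\ket0_E=\ket0\ket{e_2}+\ket1\ket{e_3}$, $V\ket0\ket f=\ket0\ket{f_0}+\ket1\ket{f_1}$, $V\ket1\ket e=\ket0\ket{f_2}+\ket1\ket{f_3}$. Assume $\braket{e_0|e_0}=\braket{e_3|e_3}=\braket{f_0|f_0}=\braket{f_3|f_3}=1-Q$ and $\braket{e_1|e_1}=\braket{e_2|e_2}=\braket{f_1|f_1}=\braket{f_2|f_2}=Q$.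 Let $W=(I_{A_1}\otimes V)\mathbf{Rw}$, let $\tau=W\ket{\Phi^+}\bra{\Phi^+}W^*$ with $\ket{\Phi^+}=\tfrac1{\sqrt2}(\ket{00}+\ket{11})$ (the Reflect state of $\Pi^*$ with $p_0=1/2$), and let $\sigma=\tfrac12 W\ket{00}\bra{00}W^*+\tfrac12W\ket{11}\bra{11}W^*$ (the Measure-and-Resend state of $\Pi^*$ with $p_0=1/2$, Bob's register traced out). Set \[ \delta=2Q(1-Q)+\Big(\tfrac12+2Q(1-Q)\Big)\,h\!\left(\frac{4Q(1-Q)}{1+4Q(1-Q)}\right). \] Then $S(A_1^Z|E)_\sigma\ge f(Q)$, where $f(Q)=S(A_1^Z|E)_\tau-\delta$ if $S(A_1^Z|E)_\tau\ge2\delta$, and $f(Q)=\tfrac12S(A_1^Z|E)_\tau$ otherwise.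
   Context: $\mathcal{H}_{A_1}=\mathcal{H}_{A_2}=\mathbb{C}^2$; $\mathcal{H}_E$ is a finite-dimensional Hilbert space with fixed orthonormal vectors $\ket0_E,\ket1_E$; $\mathbb{D}=\{z\in\mathbb{C}:|z|\le1\}$. $h$ is the binary entropy (base-2 logarithms). For a state $\rho$ on $A_1A_2E$, $S(A_1^Z|E)_\rho=S(A_1^ZE)-S(E)$ evaluated on $\rho_{A_1^ZE}=\sum_{a\in\{0,1\}}\ket a\bra a\otimes\mathrm{tr}_{A_1A_2}[(\ket a\bra a_{A_1}\otimes I)\rho]$, i.e. after measuring $A_1$ in the computational basis and tracing out $A_2$. *)

theory Defs
  imports "Jordan_Normal_Form.Schur_Decomposition"
          "HOL-Computational_Algebra.Fundamental_Theorem_Algebra"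
begin

text \<open>Tensor (Kronecker) product of vectors and matrices; the basis index of
  a tensor product is (i, k) mapped to i * dim2 + k.\<close>

definition tensor_vec :: "complex vec \<Rightarrow> complex vec \<Rightarrow> complex vec" where
  "tensor_vec u v = vec (dim_vec u * dim_vec v)
     (\<lambda>i. u $ (i div dim_vec v) * v $ (i mod dim_vec v))"

definition kron :: "complex mat \<Rightarrow> complex mat \<Rightarrow> complex mat" where
  "kron A B = mat (dim_row A * dim_row B) (dim_col A * dim_col B)
     (\<lambda>(i, j). A $$ (i div dim_row B, j div dim_col B) * B $$ (i mod dim_row B, j mod dim_col B))"

definition ket :: "nat \<Rightarrow> complex vec" where
  "ket a = unit_vec 2 a"

definition outer :: "complex vec \<Rightarrow> complex vec \<Rightarrow> complex mat" where
  "outer u v = mat (dim_vec u) (dim_vec v) (\<lambda>(i, j). u $ i * cnj (v $ j))"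

definition unitary_mat :: "nat \<Rightarrow> complex mat \<Rightarrow> bool" where
  "unitary_mat n U \<longleftrightarrow> U \<in> carrier_mat n n \<and> U * mat_adjoint U = 1\<^sub>m n \<and> mat_adjoint U * U = 1\<^sub>m n"

definition ptrace_left :: "nat \<Rightarrow> complex mat \<Rightarrow> complex mat" where
  "ptrace_left n \<rho> = (let m = dim_row \<rho> div n in
     mat m m (\<lambda>(k, l). \<Sum>i<n. \<rho> $$ (i * m + k, i * m + l)))"

definition entr_term :: "real \<Rightarrow> real" where
  "entr_term x = (if x \<le> 0 then 0 else - x * log 2 x)"

definition vN_entropy :: "complex mat \<Rightarrow> real" where
  "vN_entropy \<rho> = (\<Sum>x\<in>#proots (char_poly \<rho>). entr_term (Re x))"

definition bin_entropy :: "real \<Rightarrow> real" where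
  "bin_entropy p = entr_term p + entr_term (1 - p)"

text \<open>For a state on A1 A2 E (A1, A2 qubits, E of dimension d): the
  classical-quantum state obtained by measuring A1 in the computational basis
  and tracing out A2:
  rho_{A1^Z E} = sum_a |a><a| (x) tr_{A1A2}[(|a><a|_{A1} (x) I) rho].\<close>
definition cq_state :: "nat \<Rightarrow> complex mat \<Rightarrow> complex mat" where
  "cq_state d \<rho> =
     kron (outer (ket 0) (ket 0))
          (ptrace_left 4 (kron (kron (outer (ket 0) (ket 0)) (1\<^sub>m 2)) (1\<^sub>m d) * \<rho>))
   + kron (outer (ket 1) (ket 1))
          (ptrace_left 4 (kron (kron (outer (ket 1) (ket 1)) (1\<^sub>m 2)) (1\<^sub>m d) * \<rho>))"

definition cond_entropy_ZE :: "nat \<Rightarrow> complex mat \<Rightarrow> real" where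
  "cond_entropy_ZE d \<rho> = vN_entropy (cq_state d \<rho>) - vN_entropy (ptrace_left 2 (cq_state d \<rho>))"

end

theory Submission
  imports Defs
begin

text \<open>The state \<open>\<sigma>\<close> is the even mixture of \<open>\<tau>\<close> and the state \<open>\<tau>'\<close> obtained from
  \<open>W |\<Phi>\<^sup>-\<rangle>\<close>, so concavity of the conditional entropy gives
  \<open>S(\<sigma>) \<ge> (S(\<tau>) + S(\<tau>')) / 2\<close>. Nonnegativity of \<open>S(\<tau>')\<close> yields \<open>S(\<tau>) / 2\<close>, and a continuity
  bound of Alicki--Fannes--Winter type for \<open>\<tau>, \<tau>'\<close> at trace distance \<open>4 Q (1 - Q)\<close> yields
  \<open>S(\<tau>) - \<delta>\<close>.
  Concavity is joint convexity of the relative entropy, which is an integral of quadratic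
  divergences, each of them a supremum of functions linear in the two arguments.\<close>

subsection \<open>Spectral theorem\<close>

text \<open>The constant in delta comes from a rescaling freedom. The blocks of tau and tau' differ
  by products of \<open>x i\<close> with the adjoint of \<open>y i\<close>, plus adjoints, and such
  a product is unchanged when a scalar weight moves from one vector to the other. By polarization
  the difference equals P - N with explicit positive P and N. The total trace of P is half the sum
  of all squared norms, and by the arithmetic-geometric mean inequality this is least when the two
  vectors of each product have equal norm. In the attack all eight then have squared norm Q(1-Q), so
  epsilon = 4Q(1-Q); averaging with tau' halves the continuity bound, which gives delta. Blocks stay
  unnormalised: concavity becomes superadditivity of \<open>cond_ent\<close>, combined only with
  scaling by 2. Logarithms of matrices never appear: \<open>spectral\<close> exhibits a
  diagonalisation, and relative entropy is a scalar sum over pairs of eigenvalues weighted by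
  \<open>overlap\<close>. Its infinite values are excluded by \<open>supported\<close>, which is
  automatic when the second argument is a sum of positive matrices containing the first.\<close>

lemma mat_adjoint_eq:
  fixes A :: "complex mat"
  shows "mat_adjoint A = mat (dim_col A) (dim_row A) (\<lambda>(i, j). cnj (A $$ (j, i)))"
  unfolding mat_adjoint_def by (rule eq_matI) (auto simp: mat_of_rows_def)

lemma mat_adjoint_carrier [simp]:
  "A \<in> carrier_mat n m \<Longrightarrow> mat_adjoint (A :: complex mat) \<in> carrier_mat m n"
  by (simp add: mat_adjoint_eq)

lemma mat_adjoint_dim [simp]:
  "dim_row (mat_adjoint (A :: complex mat)) = dim_col A"
  "dim_col (mat_adjoint (A :: complex mat)) = dim_row A"
  by (simp_all add: mat_adjoint_eq)

lemma mat_adjoint_index [simp]: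
  "i < dim_col A \<Longrightarrow> j < dim_row A \<Longrightarrow> mat_adjoint (A :: complex mat) $$ (i, j) = cnj (A $$ (j, i))"
  by (simp add: mat_adjoint_eq)

lemma mat_adjoint_adjoint [simp]: "mat_adjoint (mat_adjoint (A :: complex mat)) = A"
  by (rule eq_matI) auto

lemma times_mat_index:
  assumes "A \<in> carrier_mat n m" "B \<in> carrier_mat m k" "i < n" "j < k"
  shows "(A * B) $$ (i, j) = (\<Sum>l<m. A $$ (i, l) * B $$ (l, j))"
  using assms by (auto simp: scalar_prod_def lessThan_atLeast0 intro!: sum.cong)

lemma mat_adjoint_mult:
  fixes A B :: "complex mat"
  assumes "A \<in> carrier_mat n m" "B \<in> carrier_mat m k"
  shows "mat_adjoint (A * B) = mat_adjoint B * mat_adjoint A"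
  by (rule eq_matI, insert assms) (auto simp: scalar_prod_def mult.commute intro!: sum.cong)

lemma unitary_mat_carrier: "unitary_mat n U \<Longrightarrow> U \<in> carrier_mat n n"
  by (simp add: unitary_mat_def)

lemma unitary_matI:
  assumes "U \<in> carrier_mat n n" "mat_adjoint U * U = 1\<^sub>m n"
  shows "unitary_mat n U"
  using assms mat_mult_left_right_inverse[of "mat_adjoint U" n U] by (simp add: unitary_mat_def)

lemma unitary_mat_mult:
  assumes "unitary_mat n U" "unitary_mat n V"
  shows "unitary_mat n (U * V)"
proof (rule unitary_matI)
  have U: "U \<in> carrier_mat n n" and V: "V \<in> carrier_mat n n"
    using assms by (simp_all add: unitary_mat_def)
  then show "U * V \<in> carrier_mat n n" by simp
  have "mat_adjoint (U * V) * (U * V) = mat_adjoint V * mat_adjoint U * (U * V)"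
    by (subst mat_adjoint_mult[OF U V]) simp
  also have "\<dots> = mat_adjoint V * (mat_adjoint U * (U * V))"
    by (rule assoc_mult_mat) (use U V in auto)
  also have "\<dots> = mat_adjoint V * ((mat_adjoint U * U) * V)"
    by (subst assoc_mult_mat[of "mat_adjoint U" n n U n V n]) (use U V in auto)
  finally show "mat_adjoint (U * V) * (U * V) = 1\<^sub>m n"
    using assms V by (simp add: unitary_mat_def)
qed

text \<open>Gram-Schmidt applied to a basis completion of \<open>v\<close> keeps \<open>v\<close> as
  its first vector. The output is orthogonal but not normalised, so every column is divided by its
  norm; \<open>c\<close> is the resulting factor on \<open>v\<close>.\<close>

lemma unitary_mat_first_col:
  fixes v :: "complex vec"
  assumes v: "v \<in> carrier_vec n" "v \<noteq> 0\<^sub>v n"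
  obtains U c where "unitary_mat n U" "col U 0 = c \<cdot>\<^sub>v v"
proof -
  interpret cof_vec_space n "TYPE(complex)" .
  define ws where "ws = gram_schmidt n (basis_completion v)"
  note b = basis_completion[OF v]
  from v have n: "n \<noteq> 0" by auto
  have ws: "set ws \<subseteq> carrier_vec n" "corthogonal ws" "length ws = n"
    using gram_schmidt_result[OF b(2,4,5) refl] b(6) by (auto simp: ws_def)
  have "hd ws = v"
    using b(6,7) n gram_schmidt_hd[OF v(1)] unfolding ws_def by (cases "basis_completion v") auto
  then have ws0: "ws ! 0 = v" using ws(3) n by (cases ws) auto
  define r where "r = (\<lambda>j. sqrt (Re (ws ! j \<bullet>c ws ! j)))"
  have sp: "ws ! j \<bullet>c ws ! j = complex_of_real ((r j)\<^sup>2)" "r j \<noteq> 0" if "j < n" for j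
  proof -
    have c: "ws ! j \<in> carrier_vec n" using ws that by auto
    have ge: "0 \<le> ws ! j \<bullet>c ws ! j" by (rule conjugate_square_ge_0_vec)
    have ne: "ws ! j \<bullet>c ws ! j \<noteq> 0" using corthogonalD[OF ws(2), of j j] ws(3) that by auto
    from ge have "Im (ws ! j \<bullet>c ws ! j) = 0" "0 \<le> Re (ws ! j \<bullet>c ws ! j)"
      by (simp_all add: less_eq_complex_def)
    with ne show "ws ! j \<bullet>c ws ! j = complex_of_real ((r j)\<^sup>2)" "r j \<noteq> 0"
      by (auto simp: r_def complex_eq_iff)
  qed
  define U where "U = mat n n (\<lambda>(i, j). ws ! j $ i / complex_of_real (r j))"
  have U: "U \<in> carrier_mat n n" by (simp add: U_def)
  have "mat_adjoint U * U = 1\<^sub>m n"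
  proof (rule eq_matI)
    fix i j assume "i < dim_row (1\<^sub>m n :: complex mat)" "j < dim_col (1\<^sub>m n :: complex mat)"
    then have ij: "i < n" "j < n" by auto
    have len: "dim_vec (ws ! i) = n" "dim_vec (ws ! j) = n" using ws ij by (metis carrier_vecD nth_mem subsetD)+
    have "(mat_adjoint U * U) $$ (i, j)
        = (\<Sum>k<n. mat_adjoint U $$ (i, k) * U $$ (k, j))"
      by (rule times_mat_index) (use U ij in auto)
    also have "\<dots> = (\<Sum>k<n. ws ! j $ k * cnj (ws ! i $ k) / (complex_of_real (r i) * complex_of_real (r j)))"
      by (rule sum.cong) (use U ij in \<open>auto simp: U_def\<close>)
    also have "\<dots> = (\<Sum>k<n. ws ! j $ k * cnj (ws ! i $ k)) / (complex_of_real (r i) * complex_of_real (r j))"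
      by (simp add: sum_divide_distrib)
    also have "(\<Sum>k<n. ws ! j $ k * cnj (ws ! i $ k)) = ws ! j \<bullet>c ws ! i"
      using len by (simp add: scalar_prod_def lessThan_atLeast0)
    also have "\<dots> / (complex_of_real (r i) * complex_of_real (r j)) = 1\<^sub>m n $$ (i, j)"
    proof (cases "i = j")
      case True
      then show ?thesis using sp[of j] ij by (simp add: power2_eq_square)
    next
      case False
      then show ?thesis using corthogonalD[OF ws(2), of j i] ij ws(3) by simp
    qed
    finally show "(mat_adjoint U * U) $$ (i, j) = 1\<^sub>m n $$ (i, j)" .
  qed (use U in auto)
  then have "unitary_mat n U" by (rule unitary_matI[OF U])
  moreover have "col U 0 = (1 / complex_of_real (r 0)) \<cdot>\<^sub>v v"
    using n v by (intro eq_vecI) (auto simp: U_def ws0)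
  ultimately show ?thesis using that by blast
qed

definition rdiag :: "nat \<Rightarrow> (nat \<Rightarrow> real) \<Rightarrow> complex mat" where
  "rdiag n p = mat n n (\<lambda>(i, j). if i = j then complex_of_real (p i) else 0)"

lemma rdiag_carrier [simp]: "rdiag n p \<in> carrier_mat n n"
  by (simp add: rdiag_def)

lemma rdiag_dim [simp]: "dim_row (rdiag n p) = n" "dim_col (rdiag n p) = n"
  by (simp_all add: rdiag_def)

text \<open>Deflation: in an orthonormal basis that starts with an eigenvector, the first column of
  the matrix is \<open>e\<close> times the first unit vector. Hermiticity then clears the first row
  as well and makes \<open>e\<close> real, and the induction hypothesis diagonalises the remaining
  block.\<close>

lemma hermitian_spectral:
  fixes A :: "complex mat"
  assumes "A \<in> carrier_mat n n" "mat_adjoint A = A"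
  shows "\<exists>U p. unitary_mat n U \<and> A = U * rdiag n p * mat_adjoint U"
  using assms
proof (induction n arbitrary: A)
  case 0
  then have "unitary_mat 0 (1\<^sub>m 0) \<and> A = 1\<^sub>m 0 * rdiag 0 (\<lambda>_. 0) * mat_adjoint (1\<^sub>m 0)"
    by (auto simp: unitary_mat_def)
  then show ?case by blast
next
  case (Suc n A)
  let ?N = "Suc n"
  note A = Suc.prems(1)
  obtain as where as: "char_poly A = (\<Prod>a\<leftarrow>as. [:- a, 1:])" "length as = ?N"
    using char_poly_factorized[OF A] by auto
  then obtain e as' where "as = e # as'" by (cases as) auto
  with as have "poly (char_poly A) e = 0" by simp
  then obtain v where "eigenvector A v e"
    using eigenvalue_root_char_poly[OF A] by (auto simp: eigenvalue_def)
  then have v: "v \<in> carrier_vec ?N" "v \<noteq> 0\<^sub>v ?N" "A *\<^sub>v v = e \<cdot>\<^sub>v v"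
    using A by (auto simp: eigenvector_def)
  obtain U c where U: "unitary_mat ?N U" and col: "col U 0 = c \<cdot>\<^sub>v v"
    using unitary_mat_first_col[OF v(1,2)] .
  have Uc: "U \<in> carrier_mat ?N ?N" and Uac: "mat_adjoint U \<in> carrier_mat ?N ?N"
    and UU: "U * mat_adjoint U = 1\<^sub>m ?N" "mat_adjoint U * U = 1\<^sub>m ?N"
    using U by (auto simp: unitary_mat_def)
  define A' where "A' = mat_adjoint U * (A * U)"
  have A'c: "A' \<in> carrier_mat ?N ?N"
    unfolding A'_def by (rule mult_carrier_mat[OF Uac mult_carrier_mat[OF A Uc]])
  have AU: "A * U \<in> carrier_mat ?N ?N" using A Uc by simp
  have herm: "mat_adjoint A' = A'"
  proof -
    have "mat_adjoint A' = mat_adjoint (A * U) * U"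
      unfolding A'_def by (subst mat_adjoint_mult[OF Uac AU]) simp
    also have "mat_adjoint (A * U) = mat_adjoint U * A"
      by (subst mat_adjoint_mult[OF A Uc]) (simp add: Suc.prems)
    finally show ?thesis unfolding A'_def using assoc_mult_mat[OF Uac A Uc] by simp
  qed
  have AUcol: "col (A * U) 0 = e \<cdot>\<^sub>v col U 0"
  proof -
    have "col (A * U) 0 = A *\<^sub>v col U 0" by (rule col_mult2[OF A Uc]) simp
    then show ?thesis using A v by (simp add: col mult_mat_vec smult_smult_assoc mult.commute)
  qed
  have col0: "A' $$ (i, 0) = (if i = 0 then e else 0)" if i: "i < ?N" for i
  proof -
    have "A' $$ (i, 0) = row (mat_adjoint U) i \<bullet> col (A * U) 0"
      unfolding A'_def by (rule index_mult_mat) (use i A Uc in auto)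
    also have "\<dots> = e * (row (mat_adjoint U) i \<bullet> col U 0)"
      using Uc Uac i by (simp add: AUcol)
    also have "row (mat_adjoint U) i \<bullet> col U 0 = (mat_adjoint U * U) $$ (i, 0)"
      using i Uc by simp
    finally show ?thesis using UU i by simp
  qed
  have symm: "A' $$ (i, j) = cnj (A' $$ (j, i))" if "i < ?N" "j < ?N" for i j
    using arg_cong[OF herm, of "\<lambda>M. M $$ (i, j)"] A'c that by simp
  from symm[of 0 0] col0[of 0] have e: "e = complex_of_real (Re e)"
    by (simp add: complex_eq_iff)
  define B where "B = mat n n (\<lambda>(i, j). A' $$ (Suc i, Suc j))"
  have Bc: "B \<in> carrier_mat n n" by (simp add: B_def)
  have "mat_adjoint B = B"
    by (rule eq_matI) (auto simp: B_def symm[symmetric])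
  from Suc.IH[OF Bc this] obtain W p where W: "unitary_mat n W" and B: "B = W * rdiag n p * mat_adjoint W"
    by blast
  have Wc: "W \<in> carrier_mat n n" and WW: "W * mat_adjoint W = 1\<^sub>m n" "mat_adjoint W * W = 1\<^sub>m n"
    using W by (auto simp: unitary_mat_def)
  define W' where "W' = four_block_mat (1\<^sub>m 1) (0\<^sub>m 1 n) (0\<^sub>m n 1) W"
  define p' where "p' = case_nat (Re e) p"
  have aW': "mat_adjoint W' = four_block_mat (1\<^sub>m 1) (0\<^sub>m 1 n) (0\<^sub>m n 1) (mat_adjoint W)"
    by (rule eq_matI) (use Wc in \<open>auto simp: W'_def\<close>)
  have D: "rdiag ?N p' = four_block_mat (rdiag 1 (\<lambda>_. Re e)) (0\<^sub>m 1 n) (0\<^sub>m n 1) (rdiag n p)"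
    by (rule eq_matI) (auto simp: rdiag_def p'_def split: nat.split)
  have A'block: "A' = four_block_mat (rdiag 1 (\<lambda>_. Re e)) (0\<^sub>m 1 n) (0\<^sub>m n 1) B"
  proof (rule eq_matI)
    fix i j assume "i < dim_row (four_block_mat (rdiag 1 (\<lambda>_. Re e)) (0\<^sub>m 1 n) (0\<^sub>m n 1) B)"
      "j < dim_col (four_block_mat (rdiag 1 (\<lambda>_. Re e)) (0\<^sub>m 1 n) (0\<^sub>m n 1) B)"
    then have ij: "i < ?N" "j < ?N" using Bc by auto
    show "A' $$ (i, j) = four_block_mat (rdiag 1 (\<lambda>_. Re e)) (0\<^sub>m 1 n) (0\<^sub>m n 1) B $$ (i, j)"
      using ij Bc col0[of i] col0[of j] symm[of i j] e by (auto simp: B_def rdiag_def)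
  qed (use A'c Bc in auto)
  have W'c: "W' \<in> carrier_mat ?N ?N" using Wc by (auto simp: W'_def)
  have "mat_adjoint W' * W' = 1\<^sub>m ?N"
    unfolding aW' unfolding W'_def
    by (subst mult_four_block_mat[where ?nr1.0=1 and ?n1.0=1 and ?n2.0=n and ?nr2.0=n and ?nc1.0=1 and ?nc2.0=n])
      (use Wc WW in auto)
  then have W': "unitary_mat ?N W'" by (rule unitary_matI[OF W'c])
  have "W' * rdiag ?N p' = four_block_mat (rdiag 1 (\<lambda>_. Re e)) (0\<^sub>m 1 n) (0\<^sub>m n 1) (W * rdiag n p)"
    unfolding D unfolding W'_def
    by (subst mult_four_block_mat[where ?nr1.0=1 and ?n1.0=1 and ?n2.0=n and ?nr2.0=n and ?nc1.0=1 and ?nc2.0=n])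
      (use Wc in auto)
  then have A'eq: "W' * rdiag ?N p' * mat_adjoint W' = A'"
    unfolding aW' A'block B
    by (simp only:) (subst mult_four_block_mat[where ?nr1.0=1 and ?n1.0=1 and ?n2.0=n and ?nr2.0=n and ?nc1.0=1 and ?nc2.0=n];
      use Wc in auto)
  have "U * A' = U * mat_adjoint U * (A * U)"
    unfolding A'_def by (rule assoc_mult_mat[symmetric]) (use Uc Uac AU in auto)
  then have "U * A' = A * U" unfolding UU left_mult_one_mat[OF AU] .
  then have "U * A' * mat_adjoint U = A * (U * mat_adjoint U)"
    using assoc_mult_mat[OF A Uc Uac] by simp
  then have "A = U * A' * mat_adjoint U" using A UU by simp
  also have "\<dots> = U * (W' * rdiag ?N p' * mat_adjoint W') * mat_adjoint U"
    by (simp add: A'eq)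
  also have "\<dots> = (U * W') * rdiag ?N p' * mat_adjoint (U * W')"
  proof -
    have [simp]: "mat_adjoint (U * W') = mat_adjoint W' * mat_adjoint U"
      by (rule mat_adjoint_mult[OF Uc W'c])
    have a1: "W' * rdiag ?N p' * mat_adjoint W' = W' * (rdiag ?N p' * mat_adjoint W')"
      by (rule assoc_mult_mat) (use W'c in auto)
    have a2: "U * (W' * (rdiag ?N p' * mat_adjoint W')) = U * W' * (rdiag ?N p' * mat_adjoint W')"
      by (rule assoc_mult_mat[symmetric]) (use W'c Uc in auto)
    have a3: "U * W' * (rdiag ?N p' * mat_adjoint W') = U * W' * rdiag ?N p' * mat_adjoint W'"
      by (rule assoc_mult_mat[symmetric]) (use W'c Uc in auto)
    have a4: "U * W' * rdiag ?N p' * mat_adjoint W' * mat_adjoint U = U * W' * rdiag ?N p' * (mat_adjoint W' * mat_adjoint U)"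
      by (rule assoc_mult_mat) (use W'c Uc in auto)
    show ?thesis by (simp add: a1 a2 a3 a4)
  qed
  finally show ?case using unitary_mat_mult[OF U W'] by blast
qed

subsection \<open>Quadratic divergences\<close>

text \<open>The diagonalisation is carried as explicit data, because the divergences below are
  written as functions of eigenvalues and eigenbases.\<close>

definition spectral :: "nat \<Rightarrow> complex mat \<Rightarrow> complex mat \<Rightarrow> (nat \<Rightarrow> real) \<Rightarrow> bool" where
  "spectral d A U p \<longleftrightarrow> unitary_mat d U \<and> A = U * rdiag d p * mat_adjoint U \<and> (\<forall>i<d. 0 \<le> p i)"

definition psd :: "nat \<Rightarrow> complex mat \<Rightarrow> bool" where
  "psd d A \<longleftrightarrow> A \<in> carrier_mat d d \<and> mat_adjoint A = A \<and>
     (\<forall>v\<in>carrier_vec d. 0 \<le> Re ((A *\<^sub>v v) \<bullet>c v))"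

definition mtrace :: "complex mat \<Rightarrow> complex" where
  "mtrace A = (\<Sum>i<dim_row A. A $$ (i, i))"

lemma psd_carrier: "psd d A \<Longrightarrow> A \<in> carrier_mat d d"
  by (simp add: psd_def)

lemma unitary_mat_cancel:
  assumes "unitary_mat d U" "X \<in> carrier_mat d k"
  shows "mat_adjoint U * (U * X) = X" "U * (mat_adjoint U * X) = X"
proof -
  have U: "U \<in> carrier_mat d d" "mat_adjoint U \<in> carrier_mat d d"
    and UU: "U * mat_adjoint U = 1\<^sub>m d" "mat_adjoint U * U = 1\<^sub>m d"
    using assms by (auto simp: unitary_mat_def)
  show "mat_adjoint U * (U * X) = X"
    using assoc_mult_mat[OF U(2,1) assms(2)] assms(2) by (simp add: UU)
  show "U * (mat_adjoint U * X) = X"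
    using assoc_mult_mat[OF U assms(2)] assms(2) by (simp add: UU)
qed

lemma mtrace_comm:
  assumes "A \<in> carrier_mat n m" "B \<in> carrier_mat m n"
  shows "mtrace (A * B) = mtrace (B * A)"
proof -
  have "mtrace (A * B) = (\<Sum>i<n. \<Sum>j<m. A $$ (i, j) * B $$ (j, i))"
    using assms times_mat_index[OF assms] by (simp add: mtrace_def)
  also have "\<dots> = (\<Sum>j<m. \<Sum>i<n. B $$ (j, i) * A $$ (i, j))"
    by (subst sum.swap) (simp add: mult.commute)
  also have "\<dots> = mtrace (B * A)"
    using assms times_mat_index[OF assms(2,1)] by (simp add: mtrace_def)
  finally show ?thesis .
qed

lemma mtrace_add:
  assumes "A \<in> carrier_mat n n" "B \<in> carrier_mat n n"
  shows "mtrace (A + B) = mtrace A + mtrace B"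
  using assms by (simp add: mtrace_def sum.distrib)

lemma rdiag_mult_index:
  assumes "M \<in> carrier_mat d k" "i < d" "j < k"
  shows "(rdiag d p * M) $$ (i, j) = complex_of_real (p i) * M $$ (i, j)"
proof -
  have "(rdiag d p * M) $$ (i, j) = (\<Sum>l<d. rdiag d p $$ (i, l) * M $$ (l, j))"
    by (rule times_mat_index) (use assms in auto)
  also have "\<dots> = (\<Sum>l<d. if l = i then complex_of_real (p i) * M $$ (i, j) else 0)"
    by (rule sum.cong) (use assms in \<open>auto simp: rdiag_def\<close>)
  finally show ?thesis using assms by simp
qed

lemma mtrace_adjoint_mult:
  assumes "Y \<in> carrier_mat d k" "M \<in> carrier_mat d k"
  shows "mtrace (mat_adjoint Y * M) = (\<Sum>i<d. \<Sum>j<k. cnj (Y $$ (i, j)) * M $$ (i, j))"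
proof -
  have "mtrace (mat_adjoint Y * M) = (\<Sum>j<k. \<Sum>i<d. cnj (Y $$ (i, j)) * M $$ (i, j))"
    using assms times_mat_index[OF mat_adjoint_carrier[OF assms(1)] assms(2)]
    by (simp add: mtrace_def)
  also have "\<dots> = (\<Sum>i<d. \<Sum>j<k. cnj (Y $$ (i, j)) * M $$ (i, j))"
    by (rule sum.swap)
  finally show ?thesis .
qed

context
  fixes d A U p
  assumes sp: "spectral d A U p"
begin

lemma spectral_U: "unitary_mat d U" "U \<in> carrier_mat d d" "mat_adjoint U \<in> carrier_mat d d"
  using sp by (auto simp: spectral_def unitary_mat_def)

lemma spectral_nonneg: "i < d \<Longrightarrow> 0 \<le> p i"
  using sp by (auto simp: spectral_def)

lemma spectral_eq: "A = U * rdiag d p * mat_adjoint U"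
  using sp by (auto simp: spectral_def)

lemma spectral_carrier: "A \<in> carrier_mat d d"
  unfolding spectral_eq by (intro mult_carrier_mat) (use spectral_U in auto)

lemma spectral_trace: "mtrace A = complex_of_real (\<Sum>i<d. p i)"
proof -
  have "mtrace A = mtrace (mat_adjoint U * (U * rdiag d p))"
    unfolding spectral_eq by (rule mtrace_comm) (use spectral_U in auto)
  also have "\<dots> = mtrace (rdiag d p)"
    using unitary_mat_cancel(1)[OF spectral_U(1) rdiag_carrier] by simp
  finally show ?thesis by (simp add: mtrace_def rdiag_def)
qed

text \<open>Similar matrices share their characteristic polynomial, so the multiset of its roots is
  the list of eigenvalues with multiplicity.\<close>

lemma vN_entropy_spectral: "vN_entropy A = (\<Sum>i<d. entr_term (p i))"
proof -
  have "similar_mat A (rdiag d p)"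
    by (rule similar_matI[where P = U and Q = "mat_adjoint U" and n = d])
      (use spectral_carrier spectral_U sp in \<open>auto simp: spectral_def unitary_mat_def\<close>)
  then have "char_poly A = char_poly (rdiag d p)" by (rule char_poly_similar)
  also have "\<dots> = (\<Prod>a\<leftarrow>diag_mat (rdiag d p). [:- a, 1:])"
    by (rule char_poly_upper_triangular) (auto simp: rdiag_def)
  also have "diag_mat (rdiag d p) = map (\<lambda>i. complex_of_real (p i)) [0..<d]"
    by (simp add: diag_mat_def rdiag_def)
  finally have "char_poly A = (\<Prod>i\<leftarrow>[0..<d]. [:- complex_of_real (p i), 1:])"
    by (simp add: o_def)
  then have "char_poly A = (\<Prod>i<d. [:- complex_of_real (p i), 1:])"
    by (simp add: prod.list_conv_set_nth lessThan_atLeast0)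
  then have "proots (char_poly A) = (\<Sum>i<d. {#complex_of_real (p i)#})"
    by (simp add: proots_prod)
  \<comment> \<open>Stated for an arbitrary bound \<open>k\<close>, since \<open>d\<close> is fixed
    by the context and cannot be the induction variable.\<close>
  moreover have "(\<Sum>x\<in>#(\<Sum>i<k. {#complex_of_real (p i)#}). entr_term (Re x)) = (\<Sum>i<k. entr_term (p i))" for k
    by (induction k) auto
  ultimately show ?thesis by (simp add: vN_entropy_def)
qed

end

text \<open>Nonnegativity of the eigenvalues is the quadratic form tested on the columns of
  \<open>U\<close>.\<close>

lemma psd_spectral:
  assumes "psd d A"
  obtains U p where "spectral d A U p"
proof -
  have A: "A \<in> carrier_mat d d" using assms by (simp add: psd_def)
  obtain U p where U: "unitary_mat d U" and eq: "A = U * rdiag d p * mat_adjoint U"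
    using hermitian_spectral[OF A] assms by (auto simp: psd_def)
  have Uc: "U \<in> carrier_mat d d" "mat_adjoint U \<in> carrier_mat d d"
    using U by (auto simp: unitary_mat_def)
  have AU: "A * U = U * rdiag d p"
  proof -
    have "A * U = U * rdiag d p * (mat_adjoint U * U)"
      unfolding eq by (rule assoc_mult_mat) (use Uc in auto)
    then show ?thesis using U Uc by (simp add: unitary_mat_def)
  qed
  have "0 \<le> p i" if i: "i < d" for i
  proof -
    have "0 \<le> Re ((A *\<^sub>v col U i) \<bullet>c col U i)"
      using assms Uc i by (simp add: psd_def)
    also have "A *\<^sub>v col U i = col (A * U) i" using col_mult2[OF A Uc(1) i] by simp
    also have "\<dots> \<bullet>c col U i = (mat_adjoint U * (U * rdiag d p)) $$ (i, i)"
      unfolding AU using Uc i times_mat_index[OF Uc(2), of "U * rdiag d p" d i i]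
      by (simp add: scalar_prod_def lessThan_atLeast0 mult.commute)
    also have "\<dots> = p i"
      using i unitary_mat_cancel(1)[OF U, of "rdiag d p" d] by (simp add: rdiag_def)
    finally show ?thesis by simp
  qed
  then show ?thesis using that U eq by (auto simp: spectral_def)
qed

text \<open>The squared modulus of the inner product of column \<open>i\<close> of \<open>U\<close>
  with column \<open>j\<close> of \<open>V\<close>. For unitaries this is a doubly stochastic
  matrix, a weight on pairs of eigenvalues.\<close>

definition overlap :: "complex mat \<Rightarrow> complex mat \<Rightarrow> nat \<Rightarrow> nat \<Rightarrow> real" where
  "overlap U V i j = (cmod ((mat_adjoint U * V) $$ (i, j)))\<^sup>2"

lemma overlap_nonneg [simp]: "0 \<le> overlap U V i j"
  by (simp add: overlap_def)

lemma unitary_row_sum: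
  assumes "unitary_mat d W" "i < d"
  shows "(\<Sum>j<d. (cmod (W $$ (i, j)))\<^sup>2) = 1" "(\<Sum>j<d. (cmod (W $$ (j, i)))\<^sup>2) = 1"
proof -
  have W: "W \<in> carrier_mat d d" "mat_adjoint W \<in> carrier_mat d d" "W * mat_adjoint W = 1\<^sub>m d" "mat_adjoint W * W = 1\<^sub>m d"
    using assms by (auto simp: unitary_mat_def)
  have "complex_of_real (\<Sum>j<d. (cmod (W $$ (i, j)))\<^sup>2) = (W * mat_adjoint W) $$ (i, i)"
    using W(1) assms times_mat_index[OF W(1,2)] by (simp add: complex_norm_square del: of_real_power)
  then show "(\<Sum>j<d. (cmod (W $$ (i, j)))\<^sup>2) = 1"
    unfolding W(3) using assms by (simp add: of_real_eq_1_iff del: of_real_sum of_real_power)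
  have "complex_of_real (\<Sum>j<d. (cmod (W $$ (j, i)))\<^sup>2) = (mat_adjoint W * W) $$ (i, i)"
    using W(1) assms times_mat_index[OF W(2,1)] by (simp add: complex_norm_square mult.commute del: of_real_power)
  then show "(\<Sum>j<d. (cmod (W $$ (j, i)))\<^sup>2) = 1"
    unfolding W(4) using assms by (simp add: of_real_eq_1_iff del: of_real_sum of_real_power)
qed

lemma unitary_mat_adjoint: "unitary_mat d U \<Longrightarrow> unitary_mat d (mat_adjoint U)"
  by (auto simp: unitary_mat_def)

lemma overlap_sums:
  assumes "unitary_mat d U" "unitary_mat d V" "i < d"
  shows "(\<Sum>j<d. overlap U V i j) = 1" "(\<Sum>j<d. overlap U V j i) = 1"
  unfolding overlap_def
  using unitary_row_sum[OF unitary_mat_mult[OF unitary_mat_adjoint[OF assms(1)] assms(2)] assms(3)]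
  by simp_all

text \<open>Linear in the pair \<open>(A, C)\<close> for fixed \<open>Z\<close>; its supremum over \<open>Z\<close> is the quadratic
  divergence \<open>chi\<close> below, which is therefore sublinear.\<close>

definition chi_form :: "real \<Rightarrow> complex mat \<Rightarrow> complex mat \<Rightarrow> complex mat \<Rightarrow> real" where
  "chi_form u Z A C = 2 * Re (mtrace (mat_adjoint Z * A) - mtrace (mat_adjoint Z * C))
     - u * Re (mtrace (mat_adjoint Z * (A * Z))) - (1 - u) * Re (mtrace (Z * (C * mat_adjoint Z)))"

text \<open>With D = A - C this is the inner product of D with the image of D under the inverse of X
  -> u A X + (1-u) X C. That map is diagonal in the eigenbasis of A on the left and of C on the
  right, with eigenvalues u p_i + (1-u) q_j. For 0 < u < 1 a denominator vanishes only together with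
  its numerator, and the quotient is then 0.\<close>

definition chi :: "nat \<Rightarrow> real \<Rightarrow> complex mat \<Rightarrow> (nat \<Rightarrow> real) \<Rightarrow> complex mat \<Rightarrow> (nat \<Rightarrow> real) \<Rightarrow> real" where
  "chi d u U p V q = (\<Sum>i<d. \<Sum>j<d. overlap U V i j * ((p i - q j)\<^sup>2 / (u * p i + (1 - u) * q j)))"

lemma chi_form_add:
  assumes "Z \<in> carrier_mat d d" "A \<in> carrier_mat d d" "C \<in> carrier_mat d d"
    "A' \<in> carrier_mat d d" "C' \<in> carrier_mat d d"
  shows "chi_form u Z (A + A') (C + C') = chi_form u Z A C + chi_form u Z A' C'"
proof -
  note c = assms mat_adjoint_carrier[OF assms(1)]
  have "mtrace (mat_adjoint Z * (A + A')) = mtrace (mat_adjoint Z * A) + mtrace (mat_adjoint Z * A')"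
    by (subst mult_add_distrib_mat[of _ d d _ d]; (subst mtrace_add[of _ d])?; use c in \<open>auto intro!: mult_carrier_mat\<close>)
  moreover have "mtrace (mat_adjoint Z * (C + C')) = mtrace (mat_adjoint Z * C) + mtrace (mat_adjoint Z * C')"
    by (subst mult_add_distrib_mat[of _ d d _ d]; (subst mtrace_add[of _ d])?; use c in \<open>auto intro!: mult_carrier_mat\<close>)
  moreover have "mtrace (mat_adjoint Z * ((A + A') * Z)) = mtrace (mat_adjoint Z * (A * Z)) + mtrace (mat_adjoint Z * (A' * Z))"
    by (subst add_mult_distrib_mat[of _ d d _ _ d]; (subst mult_add_distrib_mat[of _ d d _ d])?; (subst mtrace_add[of _ d])?; use c in \<open>auto intro!: mult_carrier_mat\<close>)
  moreover have "mtrace (Z * ((C + C') * mat_adjoint Z)) = mtrace (Z * (C * mat_adjoint Z)) + mtrace (Z * (C' * mat_adjoint Z))"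
    by (subst add_mult_distrib_mat[of _ d d _ _ d]; (subst mult_add_distrib_mat[of _ d d _ d])?; (subst mtrace_add[of _ d])?; use c in \<open>auto intro!: mult_carrier_mat\<close>)
  ultimately show ?thesis by (simp add: chi_form_def algebra_simps)
qed

text \<open>In mixed coordinates, \<open>U\<close> on the left and \<open>V\<close> on the right,
  left multiplication by \<open>A\<close> and right multiplication by \<open>C\<close> are both
  diagonal, so the form splits into one scalar quadratic per entry of \<open>Y\<close>.\<close>

lemma chi_form_spectral:
  assumes A: "spectral d A U p" and C: "spectral d C V q" and Y: "Y \<in> carrier_mat d d"
  defines "Z \<equiv> U * Y * mat_adjoint V"
  shows "chi_form u Z A C = (\<Sum>i<d. \<Sum>j<d.
     2 * Re (cnj (Y $$ (i, j)) * complex_of_real (p i - q j) * (mat_adjoint U * V) $$ (i, j))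
     - (u * p i + (1 - u) * q j) * (cmod (Y $$ (i, j)))\<^sup>2)"
proof -
  note uU = spectral_U[OF A] and uV = spectral_U[OF C]
  note carr = uU(2,3) uV(2,3) Y mat_adjoint_carrier[OF Y] rdiag_carrier[of d]
  note assoc = assoc_mult_mat[of _ d d _ d _ d]
  note mc = mult_carrier_mat[of _ d d _ d]
  note adj = mat_adjoint_mult[of _ d d _ d]
  note cancel = unitary_mat_cancel[OF uU(1), of _ d] unitary_mat_cancel[OF uV(1), of _ d]
  let ?O = "mat_adjoint U * V"
  have O: "?O \<in> carrier_mat d d" using carr mc by blast
  have Zadj: "mat_adjoint Z = V * (mat_adjoint Y * mat_adjoint U)"
    unfolding Z_def using carr by (simp add: adj mc)
  have cyc: "mtrace (V * M) = mtrace (M * V)" "mtrace (U * M) = mtrace (M * U)" if "M \<in> carrier_mat d d" for M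
    using that carr by (auto intro: mtrace_comm)
  have UU: "mat_adjoint U * U = 1\<^sub>m d" "mat_adjoint V * V = 1\<^sub>m d"
    using uU(1) uV(1) by (auto simp: unitary_mat_def)
  have t1: "mtrace (mat_adjoint Z * A) = mtrace (mat_adjoint Y * (rdiag d p * ?O))"
    unfolding Zadj spectral_eq[OF A] using carr by (simp add: assoc mc cancel cyc)
  have t2: "mtrace (mat_adjoint Z * C) = mtrace (mat_adjoint Y * (?O * rdiag d q))"
    unfolding Zadj spectral_eq[OF C] using carr by (simp add: assoc mc cancel cyc UU)
  have t3: "mtrace (mat_adjoint Z * (A * Z)) = mtrace (mat_adjoint Y * (rdiag d p * Y))"
    unfolding Zadj spectral_eq[OF A] unfolding Z_def using carr by (simp add: assoc mc cancel cyc UU)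
  have t4: "mtrace (Z * (C * mat_adjoint Z)) = mtrace (mat_adjoint Y * (Y * rdiag d q))"
  proof -
    have "mtrace (Z * (C * mat_adjoint Z)) = mtrace (Y * (rdiag d q * mat_adjoint Y))"
      unfolding Zadj spectral_eq[OF C] unfolding Z_def using carr by (simp add: assoc mc cancel cyc UU)
    also have "\<dots> = mtrace ((Y * rdiag d q) * mat_adjoint Y)"
      using carr by (simp add: assoc)
    also have "\<dots> = mtrace (mat_adjoint Y * (Y * rdiag d q))"
      by (rule mtrace_comm) (use carr mc in auto)
    finally show ?thesis .
  qed
  have rd: "(M * rdiag d q) $$ (i, j) = M $$ (i, j) * complex_of_real (q j)"
    if "M \<in> carrier_mat d d" "i < d" "j < d" for M i j
  proof -
    have "(M * rdiag d q) $$ (i, j) = (\<Sum>l<d. M $$ (i, l) * rdiag d q $$ (l, j))"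
      by (rule times_mat_index) (use that in auto)
    also have "\<dots> = (\<Sum>l<d. if l = j then M $$ (i, j) * complex_of_real (q j) else 0)"
      by (rule sum.cong) (use that in \<open>auto simp: rdiag_def\<close>)
    finally show ?thesis using that by simp
  qed
  have s1: "mtrace (mat_adjoint Y * (rdiag d p * ?O)) = (\<Sum>i<d. \<Sum>j<d. cnj (Y $$ (i, j)) * (complex_of_real (p i) * ?O $$ (i, j)))"
    unfolding mtrace_adjoint_mult[OF Y mult_carrier_mat[OF rdiag_carrier O]] by (simp add: rdiag_mult_index[OF O] del: index_mult_mat)
  have s2: "mtrace (mat_adjoint Y * (?O * rdiag d q)) = (\<Sum>i<d. \<Sum>j<d. cnj (Y $$ (i, j)) * (?O $$ (i, j) * complex_of_real (q j)))"
    unfolding mtrace_adjoint_mult[OF Y mult_carrier_mat[OF O rdiag_carrier]] by (simp add: rd[OF O] del: index_mult_mat)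
  have s3: "mtrace (mat_adjoint Y * (rdiag d p * Y)) = (\<Sum>i<d. \<Sum>j<d. cnj (Y $$ (i, j)) * (complex_of_real (p i) * Y $$ (i, j)))"
    unfolding mtrace_adjoint_mult[OF Y mult_carrier_mat[OF rdiag_carrier Y]] by (simp add: rdiag_mult_index[OF Y] del: index_mult_mat)
  have s4: "mtrace (mat_adjoint Y * (Y * rdiag d q)) = (\<Sum>i<d. \<Sum>j<d. cnj (Y $$ (i, j)) * (Y $$ (i, j) * complex_of_real (q j)))"
    unfolding mtrace_adjoint_mult[OF Y mult_carrier_mat[OF Y rdiag_carrier]] by (simp add: rd[OF Y] del: index_mult_mat)
  have nrm: "Re (cnj y * (complex_of_real r * y)) = r * (cmod y)\<^sup>2" for y r
    unfolding cmod_power2 by (simp add: algebra_simps power2_eq_square)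
  have nrm': "Re (cnj y * (y * complex_of_real r)) = r * (cmod y)\<^sup>2" for y r
    unfolding cmod_power2 by (simp add: algebra_simps power2_eq_square)
  show ?thesis
    unfolding chi_form_def t1 t2 t3 t4 s1 s2 s3 s4 Re_sum minus_complex.sel
      sum_distrib_left sum_subtractf[symmetric] nrm nrm'
    by (intro sum.cong refl) (simp add: algebra_simps)
qed

text \<open>Completing the square in \<open>y\<close>.\<close>

lemma quadratic_max:
  fixes y w :: complex and D L :: real
  assumes "0 < L"
  shows "2 * Re (cnj y * complex_of_real D * w) - L * (cmod y)\<^sup>2 \<le> (cmod w)\<^sup>2 * (D\<^sup>2 / L)"
proof -
  have "0 \<le> (cmod (complex_of_real L * y - complex_of_real D * w))\<^sup>2" by simp
  also have "\<dots> = L\<^sup>2 * (cmod y)\<^sup>2 - 2 * L * Re (cnj y * complex_of_real D * w) + D\<^sup>2 * (cmod w)\<^sup>2"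
    unfolding cmod_power2 by (simp add: power2_eq_square algebra_simps)
  also have "\<dots> = L * (D\<^sup>2 * (cmod w)\<^sup>2 / L - (2 * Re (cnj y * complex_of_real D * w) - L * (cmod y)\<^sup>2))"
    using assms by (simp add: field_simps power2_eq_square)
  finally show ?thesis using assms by (simp add: zero_le_mult_iff mult.commute)
qed

lemma chi_form_le_chi:
  assumes A: "spectral d A U p" and C: "spectral d C V q" and Z: "Z \<in> carrier_mat d d"
    and u: "0 < u" "u < 1"
  shows "chi_form u Z A C \<le> chi d u U p V q"
proof -
  note uU = spectral_U[OF A] and uV = spectral_U[OF C]
  define Y where "Y = mat_adjoint U * (Z * V)"
  have Y: "Y \<in> carrier_mat d d" unfolding Y_def using uU uV Z by (intro mult_carrier_mat)
  have ZV: "Z * V \<in> carrier_mat d d" using Z uV by simp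
  have "U * Y * mat_adjoint V = Z * V * mat_adjoint V"
    unfolding Y_def using unitary_mat_cancel(2)[OF uU(1) ZV] by simp
  also have "\<dots> = Z * (V * mat_adjoint V)"
    by (rule assoc_mult_mat) (use Z uV in auto)
  finally have eq: "U * Y * mat_adjoint V = Z" using Z uV by (simp add: unitary_mat_def)
  show ?thesis
    unfolding chi_form_spectral[OF A C Y, of u, unfolded eq] chi_def
  proof (intro sum_mono)
    fix i j assume "i \<in> {..<d}" "j \<in> {..<d}"
    then have nn: "0 \<le> p i" "0 \<le> q j"
      using spectral_nonneg[OF A, of i] spectral_nonneg[OF C, of j] by auto
    show "2 * Re (cnj (Y $$ (i, j)) * complex_of_real (p i - q j) * (mat_adjoint U * V) $$ (i, j))
        - (u * p i + (1 - u) * q j) * (cmod (Y $$ (i, j)))\<^sup>2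
        \<le> overlap U V i j * ((p i - q j)\<^sup>2 / (u * p i + (1 - u) * q j))"
    \<comment> \<open>If both eigenvalues vanish, the linear and the quadratic coefficient are 0,
      and so is the right-hand side.\<close>
    proof (cases "p i = 0 \<and> q j = 0")
      case False
      with nn u have "0 < u * p i + (1 - u) * q j"
        by (metis add_nonneg_pos add_pos_nonneg diff_gt_0_iff_gt less_eq_real_def mult_nonneg_nonneg mult_pos_pos)
      from quadratic_max[OF this] show ?thesis unfolding overlap_def .
    qed simp
  qed
qed

lemma chi_attained:
  assumes A: "spectral d A U p" and C: "spectral d C V q" 
    and u: "0 < u" "u < 1"
  obtains Z where "Z \<in> carrier_mat d d" "chi_form u Z A C = chi d u U p V q"
proof -
  note uU = spectral_U[OF A] and uV = spectral_U[OF C]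
  \<comment> \<open>The stationary point of each scalar quadratic. Where the denominator vanishes,
    division yields 0, in agreement with the value that \<open>chi\<close> takes there.\<close>
  define Y where "Y = mat d d (\<lambda>(i, j). complex_of_real ((p i - q j) / (u * p i + (1 - u) * q j)) * (mat_adjoint U * V) $$ (i, j))"
  have Y: "Y \<in> carrier_mat d d" unfolding Y_def by simp
  have "chi_form u (U * Y * mat_adjoint V) A C = chi d u U p V q"
    unfolding chi_form_spectral[OF A C Y, of u] chi_def
  proof (intro sum.cong refl)
    fix i j assume ij: "i \<in> {..<d}" "j \<in> {..<d}"
    let ?L = "u * p i + (1 - u) * q j" and ?w = "(mat_adjoint U * V) $$ (i, j)" and ?D = "p i - q j"
    have y: "Y $$ (i, j) = complex_of_real (?D / ?L) * ?w" using ij by (simp add: Y_def)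
    have "2 * Re (cnj (Y $$ (i, j)) * complex_of_real ?D * ?w) - ?L * (cmod (Y $$ (i, j)))\<^sup>2
      = 2 * (?D / ?L * ?D) * (cmod ?w)\<^sup>2 - ?L * ((?D / ?L)\<^sup>2 * (cmod ?w)\<^sup>2)"
      unfolding y by (simp only: complex_cnj_mult complex_cnj_complex_of_real norm_mult norm_of_real power_mult_distrib power2_abs)
        (unfold cmod_power2, simp add: power2_eq_square algebra_simps)
    also have "\<dots> = (cmod ?w)\<^sup>2 * (?D\<^sup>2 / ?L)"
    proof -
      have "2 * (D / L * D) * N - L * ((D / L)\<^sup>2 * N) = N * (D\<^sup>2 / L)" for D L N :: real
        by (cases "L = 0") (simp_all add: field_simps power2_eq_square)
      then show ?thesis .
    qed
    finally show "2 * Re (cnj (Y $$ (i, j)) * complex_of_real ?D * ?w) - ?L * (cmod (Y $$ (i, j)))\<^sup>2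
      = overlap U V i j * (?D\<^sup>2 / ?L)" unfolding overlap_def .
  qed
  moreover have "U * Y * mat_adjoint V \<in> carrier_mat d d"
    using uU uV Y by (intro mult_carrier_mat)
  ultimately show ?thesis using that by blast
qed

text \<open>A supremum of linear functions is subadditive: the maximiser for the sum serves as a
  test matrix for both summands.\<close>

lemma chi_subadditive:
  assumes "spectral d A U p" "spectral d C V q" "spectral d A' U' p'" "spectral d C' V' q'"
    and "spectral d (A + A') U'' p''" "spectral d (C + C') V'' q''" and u: "0 < u" "u < 1"
  shows "chi d u U'' p'' V'' q'' \<le> chi d u U p V q + chi d u U' p' V' q'"
proof -
  obtain Z where Z: "Z \<in> carrier_mat d d"
    and eq: "chi_form u Z (A + A') (C + C') = chi d u U'' p'' V'' q''"
    using chi_attained[OF assms(5,6) u] .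
  have "chi d u U'' p'' V'' q'' = chi_form u Z A C + chi_form u Z A' C'"
    unfolding eq[symmetric] by (rule chi_form_add[OF Z]) (use assms(1-4)[THEN spectral_carrier] in auto)
  then show ?thesis
    using chi_form_le_chi[OF assms(1,2) Z u] chi_form_le_chi[OF assms(3,4) Z u] by linarith
qed

subsection \<open>Relative entropy\<close>

text \<open>An antiderivative in u of (1-u)(p-q)^2 / (u p + (1-u) q). For p, q > 0 its increment
  over [0,1] is p ln p - p ln q - p + q. For p = 0 the integrand is the constant q. For q = 0 < p
  the integrand is not integrable at 0; the value 0 is a placeholder for pairs whose overlap
  vanishes under \<open>supported\<close>.\<close>

definition chi_prim :: "real \<Rightarrow> real \<Rightarrow> real \<Rightarrow> real" where
  "chi_prim p q u = (if p = 0 then q * u else if q = 0 then 0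
     else p * ln (q + u * (p - q)) - u * (p - q))"

lemma interpolation_pos:
  fixes p q u :: real
  assumes "0 < p" "0 < q" "0 \<le> u" "u \<le> 1"
  shows "0 < q + u * (p - q)"
proof -
  have "0 < u * p + (1 - u) * q"
    using assms by (cases "u = 0") (auto intro: add_pos_nonneg)
  then show ?thesis by (simp add: algebra_simps)
qed

lemma chi_prim_deriv:
  assumes "0 \<le> p" "0 \<le> q" "p = 0 \<or> q \<noteq> 0" "0 < u" "u < 1"
  shows "(chi_prim p q has_real_derivative (1 - u) * ((p - q)\<^sup>2 / (u * p + (1 - u) * q))) (at u)"
proof (cases "p = 0")
  case True
  have "((\<lambda>u. q * u) has_real_derivative q) (at u)" by (auto intro!: derivative_eq_intros)
  moreover have "(1 - u) * ((p - q)\<^sup>2 / (u * p + (1 - u) * q)) = q"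
    using True assms by (cases "q = 0") (simp_all add: field_simps power2_eq_square)
  ultimately show ?thesis using True by (simp add: chi_prim_def[abs_def])
next
  case False
  with assms have pos: "0 < p" "0 < q" by auto
  have L: "0 < q + u * (p - q)" using interpolation_pos pos assms by simp
  have "((\<lambda>u. p * ln (q + u * (p - q)) - u * (p - q)) has_real_derivative
      p * ((p - q) / (q + u * (p - q))) - (p - q)) (at u)"
    by (rule derivative_eq_intros refl | use L in simp)+
  moreover have "p * ((p - q) / (q + u * (p - q))) - (p - q) = (1 - u) * ((p - q)\<^sup>2 / (u * p + (1 - u) * q))"
  proof -
    have e: "u * p + (1 - u) * q = q + u * (p - q)" by (simp add: algebra_simps)
    show ?thesis unfolding e using L by (simp add: field_simps power2_eq_square)
  qed
  ultimately show ?thesis using pos by (simp add: chi_prim_def[abs_def])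
qed

lemma chi_prim_continuous:
  assumes "0 \<le> p" "0 \<le> q"
  shows "continuous_on {0..1} (chi_prim p q)"
proof (cases "p = 0 \<or> q = 0")
  case True
  then show ?thesis
    by (cases "p = 0") (auto simp: chi_prim_def[abs_def] intro!: continuous_intros)
next
  case False
  with assms have "0 < q + u * (p - q)" if "u \<in> {0..1}" for u
    using interpolation_pos that by simp
  then have "continuous_on {0..1} (\<lambda>u. p * ln (q + u * (p - q)) - u * (p - q))"
    by (intro continuous_intros) (use less_irrefl in force)+
  then show ?thesis using False by (simp add: chi_prim_def[abs_def])
qed

text \<open>The trace of A (ln A - ln C) with natural logarithm, expanded in the eigenbases of both
  matrices.\<close>

definition rel_ent :: "nat \<Rightarrow> complex mat \<Rightarrow> (nat \<Rightarrow> real) \<Rightarrow> complex mat \<Rightarrow> (nat \<Rightarrow> real) \<Rightarrow> real" where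
  "rel_ent d U p V q = (\<Sum>i<d. \<Sum>j<d. overlap U V i j * (p i * ln (p i) - p i * ln (q j)))"

text \<open>The kernel of the second matrix lies in the kernel of the first, which is the condition
  for finite relative entropy. Under it the value of \<open>ln\<close> at 0 never enters
  \<open>rel_ent\<close>.\<close>

definition supported :: "nat \<Rightarrow> complex mat \<Rightarrow> (nat \<Rightarrow> real) \<Rightarrow> complex mat \<Rightarrow> (nat \<Rightarrow> real) \<Rightarrow> bool" where
  "supported d U p V q \<longleftrightarrow> (\<forall>i<d. \<forall>j<d. q j = 0 \<longrightarrow> overlap U V i j * p i = 0)"

lemma overlap_weighted_sums:
  assumes "unitary_mat d U" "unitary_mat d V"
  shows "(\<Sum>i<d. \<Sum>j<d. overlap U V i j * f i) = (\<Sum>i<d. f i)"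
    "(\<Sum>i<d. \<Sum>j<d. overlap U V i j * g j) = (\<Sum>j<d. g j)"
proof -
  show "(\<Sum>i<d. \<Sum>j<d. overlap U V i j * f i) = (\<Sum>i<d. f i)"
    using overlap_sums(1)[OF assms] by (simp add: sum_distrib_right[symmetric])
  show "(\<Sum>i<d. \<Sum>j<d. overlap U V i j * g j) = (\<Sum>j<d. g j)"
    using overlap_sums(2)[OF assms] by (subst sum.swap) (simp add: sum_distrib_right[symmetric])
qed

definition chi_primitive :: "nat \<Rightarrow> complex mat \<Rightarrow> (nat \<Rightarrow> real) \<Rightarrow> complex mat \<Rightarrow> (nat \<Rightarrow> real) \<Rightarrow> real \<Rightarrow> real" where
  "chi_primitive d U p V q u = (\<Sum>i<d. \<Sum>j<d. overlap U V i j * chi_prim (p i) (q j) u)"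

context
  fixes d A U p C V q
  assumes A: "spectral d A U p" and C: "spectral d C V q" and supp: "supported d U p V q"
begin

lemma chi_primitive_deriv:
  assumes "0 < u" "u < 1"
  shows "(chi_primitive d U p V q has_real_derivative (1 - u) * chi d u U p V q) (at u)"
proof -
  have "((\<lambda>u. overlap U V i j * chi_prim (p i) (q j) u) has_real_derivative
      (1 - u) * (overlap U V i j * ((p i - q j)\<^sup>2 / (u * p i + (1 - u) * q j)))) (at u)"
    if ij: "i < d" "j < d" for i j
  proof (cases "overlap U V i j = 0")
    case False
    then have "p i = 0 \<or> q j \<noteq> 0" using supp ij by (auto simp: supported_def)
    from DERIV_cmult[OF chi_prim_deriv[OF spectral_nonneg[OF A ij(1)] spectral_nonneg[OF C ij(2)] this assms], of "overlap U V i j"]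
    show ?thesis by (simp add: mult.left_commute)
  qed simp
  then show ?thesis
    unfolding chi_primitive_def chi_def sum_distrib_left by (intro DERIV_sum) auto
qed

lemma chi_primitive_continuous: "continuous_on {0..1} (chi_primitive d U p V q)"
  unfolding chi_primitive_def
  by (intro continuous_on_sum continuous_on_mult continuous_on_const chi_prim_continuous)
    (use spectral_nonneg[OF A] spectral_nonneg[OF C] in auto)

text \<open>The integral representation of relative entropy, with the integral replaced by the
  increment of a primitive. The traces absorb the terms -p + q of each scalar increment, because the
  overlaps are doubly stochastic.\<close>

lemma rel_ent_eq_chi_primitive:
  "rel_ent d U p V q = chi_primitive d U p V q 1 - chi_primitive d U p V q 0 + Re (mtrace A) - Re (mtrace C)"
proof -
  have "rel_ent d U p V q = (\<Sum>i<d. \<Sum>j<d. overlap U V i j * chi_prim (p i) (q j) 1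
      - overlap U V i j * chi_prim (p i) (q j) 0 + overlap U V i j * p i - overlap U V i j * q j)"
    unfolding rel_ent_def
  proof (intro sum.cong refl)
    fix i j assume "i \<in> {..<d}" "j \<in> {..<d}"
    then have "q j = 0 \<Longrightarrow> overlap U V i j * p i = 0" using supp by (auto simp: supported_def)
    then show "overlap U V i j * (p i * ln (p i) - p i * ln (q j)) = overlap U V i j * chi_prim (p i) (q j) 1
      - overlap U V i j * chi_prim (p i) (q j) 0 + overlap U V i j * p i - overlap U V i j * q j"
      by (cases "q j = 0") (auto simp: chi_prim_def algebra_simps)
  qed
  also have "\<dots> = chi_primitive d U p V q 1 - chi_primitive d U p V q 0
      + (\<Sum>i<d. \<Sum>j<d. overlap U V i j * p i) - (\<Sum>i<d. \<Sum>j<d. overlap U V i j * q j)"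
    by (simp add: chi_primitive_def sum.distrib sum_subtractf)
  finally show ?thesis
    using overlap_weighted_sums[OF spectral_U(1)[OF A] spectral_U(1)[OF C]] spectral_trace[OF A] spectral_trace[OF C]
    by simp
qed

text \<open>Termwise ln t <= t - 1 at t = c q / p. The free scale \<open>c\<close> adapts the
  inequality to matrices of different trace; the best choice is the ratio of the traces.\<close>

lemma klein_inequality:
  assumes c: "0 < c"
  shows "ln c * Re (mtrace A) + Re (mtrace A) - c * Re (mtrace C) \<le> rel_ent d U p V q"
proof -
  have "(\<Sum>i<d. \<Sum>j<d. overlap U V i j * (ln c * p i + p i) - overlap U V i j * (c * q j)) \<le> rel_ent d U p V q"
    unfolding rel_ent_def
  proof (intro sum_mono)
    fix i j assume ij: "i \<in> {..<d}" "j \<in> {..<d}"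
    then have nn: "0 \<le> p i" "0 \<le> q j" using spectral_nonneg[OF A] spectral_nonneg[OF C] by auto
    show "overlap U V i j * (ln c * p i + p i) - overlap U V i j * (c * q j)
        \<le> overlap U V i j * (p i * ln (p i) - p i * ln (q j))"
    proof (cases "p i = 0 \<or> overlap U V i j = 0")
      case True
      then show ?thesis using nn c by (auto intro: mult_nonneg_nonneg)
    next
      case False
      then have pos: "0 < p i" "0 < q j" using nn supp ij by (auto simp: supported_def less_le)
      have "ln (c * q j / p i) \<le> c * q j / p i - 1" using pos c by (intro ln_le_minus_one) auto
      then have "p i * (ln c + ln (q j) - ln (p i)) \<le> p i * (c * q j / p i - 1)"
        using pos c by (intro mult_left_mono) (auto simp: ln_div ln_mult)
      then have "ln c * p i + p i - c * q j \<le> p i * ln (p i) - p i * ln (q j)"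
        using pos by (simp add: algebra_simps)
      from mult_left_mono[OF this, of "overlap U V i j"] show ?thesis by (simp add: algebra_simps)
    qed
  qed
  also have "(\<Sum>i<d. \<Sum>j<d. overlap U V i j * (ln c * p i + p i) - overlap U V i j * (c * q j))
      = ln c * Re (mtrace A) + Re (mtrace A) - c * Re (mtrace C)"
    using overlap_weighted_sums[OF spectral_U(1)[OF A] spectral_U(1)[OF C]] spectral_trace[OF A] spectral_trace[OF C]
    by (simp add: sum_subtractf sum.distrib sum_distrib_left)
  finally show ?thesis .
qed

end

text \<open>Joint convexity in its homogeneous form. The defect of the primitives has nonnegative
  derivative by subadditivity of \<open>chi\<close>, so it increases from 0 to 1; the trace terms
  are additive and cancel. Derivatives are known only in the open interval, and continuity supplies
  the endpoints.\<close>

lemma rel_ent_subadditive: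
  assumes s: "spectral d A U p" "spectral d C V q" "spectral d A' U' p'" "spectral d C' V' q'"
    "spectral d (A + A') U'' p''" "spectral d (C + C') V'' q''"
    and supp: "supported d U p V q" "supported d U' p' V' q'" "supported d U'' p'' V'' q''"
  shows "rel_ent d U'' p'' V'' q'' \<le> rel_ent d U p V q + rel_ent d U' p' V' q'"
proof -
  define f where "f = (\<lambda>u. chi_primitive d U p V q u + chi_primitive d U' p' V' q' u - chi_primitive d U'' p'' V'' q'' u)"
  have "f 0 \<le> f 1"
  proof (rule DERIV_nonneg_imp_increasing_open[where f = f])
    fix u :: real assume u: "0 < u" "u < 1"
    have "(f has_real_derivative (1 - u) * chi d u U p V q + (1 - u) * chi d u U' p' V' q'
        - (1 - u) * chi d u U'' p'' V'' q'') (at u)"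
      unfolding f_def
      by (intro DERIV_diff DERIV_add chi_primitive_deriv[OF s(1,2) supp(1) u] chi_primitive_deriv[OF s(3,4) supp(2) u]
          chi_primitive_deriv[OF s(5,6) supp(3) u])
    moreover have "0 \<le> (1 - u) * (chi d u U p V q + chi d u U' p' V' q' - chi d u U'' p'' V'' q'')"
      using chi_subadditive[OF s u] u by simp
    ultimately show "\<exists>y. (f has_real_derivative y) (at u) \<and> 0 \<le> y"
      by (auto simp: algebra_simps)
  next
    show "continuous_on {0..1} f" unfolding f_def
      by (intro continuous_on_diff continuous_on_add chi_primitive_continuous[OF s(1,2) supp(1)]
          chi_primitive_continuous[OF s(3,4) supp(2)] chi_primitive_continuous[OF s(5,6) supp(3)])
  qed simp
  moreover have "Re (mtrace (A + A')) = Re (mtrace A) + Re (mtrace A')" "Re (mtrace (C + C')) = Re (mtrace C) + Re (mtrace C')"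
    using mtrace_add s(1-4)[THEN spectral_carrier] by auto
  ultimately show ?thesis
    unfolding rel_ent_eq_chi_primitive[OF s(1,2) supp(1)] rel_ent_eq_chi_primitive[OF s(3,4) supp(2)]
      rel_ent_eq_chi_primitive[OF s(5,6) supp(3)] f_def by simp
qed

lemma psd_add:
  assumes "psd d A" "psd d B"
  shows "psd d (A + B)"
  unfolding psd_def
proof (intro conjI ballI)
  have c: "A \<in> carrier_mat d d" "B \<in> carrier_mat d d" using assms by (auto simp: psd_def)
  then show "A + B \<in> carrier_mat d d" by simp
  show "mat_adjoint (A + B) = A + B"
  proof (rule eq_matI)
    fix i j assume "i < dim_row (A + B)" "j < dim_col (A + B)"
    then have ij: "i < d" "j < d" using c by auto
    have "mat_adjoint A = A" "mat_adjoint B = B" using assms by (auto simp: psd_def)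
    from arg_cong[OF this(1), of "\<lambda>M. M $$ (i, j)"] arg_cong[OF this(2), of "\<lambda>M. M $$ (i, j)"]
    show "mat_adjoint (A + B) $$ (i, j) = (A + B) $$ (i, j)" using c ij by simp
  qed (use c in auto)
  fix v :: "complex vec" assume v: "v \<in> carrier_vec d"
  have "((A + B) *\<^sub>v v) \<bullet>c v = (A *\<^sub>v v) \<bullet>c v + (B *\<^sub>v v) \<bullet>c v"
    using c v by (subst add_mult_distrib_mat_vec[of _ d d], auto intro!: add_scalar_prod_distrib[of _ d])
  then show "0 \<le> Re (((A + B) *\<^sub>v v) \<bullet>c v)"
    using assms v by (simp add: psd_def)
qed

text \<open>Expanding column \<open>k\<close> of \<open>W\<close> in the eigenbasis of
  \<open>A\<close> turns the quadratic form into an average of eigenvalues.\<close>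

lemma spectral_quadratic_form:
  assumes A: "spectral d A U p" and W: "unitary_mat d W" and k: "k < d"
  shows "Re ((mat_adjoint W * (A * W)) $$ (k, k)) = (\<Sum>i<d. overlap U W i k * p i)"
proof -
  note uU = spectral_U[OF A]
  have Wc: "W \<in> carrier_mat d d" "mat_adjoint W \<in> carrier_mat d d" using W by (auto simp: unitary_mat_def)
  let ?M = "mat_adjoint U * W"
  have M: "?M \<in> carrier_mat d d" using uU(3) Wc(1) by (rule mult_carrier_mat)
  have adj: "mat_adjoint ?M = mat_adjoint W * U" using mat_adjoint_mult[OF uU(3) Wc(1)] by simp
  note assoc = assoc_mult_mat[of _ d d _ d _ d]
  note mc = mult_carrier_mat[of _ d d _ d]
  have "mat_adjoint W * (A * W) = mat_adjoint ?M * (rdiag d p * ?M)"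
    unfolding adj spectral_eq[OF A] using uU Wc by (simp add: assoc mc)
  then have "(mat_adjoint W * (A * W)) $$ (k, k) = (\<Sum>i<d. mat_adjoint ?M $$ (k, i) * (rdiag d p * ?M) $$ (i, k))"
    using times_mat_index[OF mat_adjoint_carrier[OF M] mult_carrier_mat[OF rdiag_carrier M] k k] by simp
  also have "\<dots> = (\<Sum>i<d. complex_of_real (overlap U W i k * p i))"
  proof (intro sum.cong refl)
    fix i assume "i \<in> {..<d}"
    then have i: "i < d" by simp
    have "mat_adjoint ?M $$ (k, i) = cnj (?M $$ (i, k))"
      by (rule mat_adjoint_index) (use M k i in auto)
    then show "mat_adjoint ?M $$ (k, i) * (rdiag d p * ?M) $$ (i, k) = complex_of_real (overlap U W i k * p i)"
      unfolding rdiag_mult_index[OF M i k] overlap_def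
      by (simp add: complex_norm_square mult_ac del: index_mult_mat of_real_power)
  qed
  finally show ?thesis by simp
qed

lemma spectral_quadratic_form_self:
  assumes C: "spectral d C W r" and k: "k < d"
  shows "Re ((mat_adjoint W * (C * W)) $$ (k, k)) = r k"
proof -
  have "overlap W W i k = (if i = k then 1 else 0)" if "i < d" for i
    using spectral_U(1)[OF C] k that by (simp add: overlap_def unitary_mat_def)
  then show ?thesis
    unfolding spectral_quadratic_form[OF C spectral_U(1)[OF C] k]
    using k by (simp add: if_distrib[of "\<lambda>x. x * _"] cong: if_cong)
qed

section \<open>Conditional entropy of a pair of positive blocks\<close>

lemma entr_term_ln: "0 \<le> x \<Longrightarrow> entr_term x * ln 2 = - (x * ln x)"
  by (auto simp: entr_term_def log_def)

text \<open>For a pair of positive blocks this is the conditional entropy of the label given the block.\<close>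

definition cond_ent :: "complex mat \<Rightarrow> complex mat \<Rightarrow> real" where
  "cond_ent A B = vN_entropy A + vN_entropy B - vN_entropy (A + B)"

context
  fixes d A B U p V q W r
  assumes A: "spectral d A U p" and B: "spectral d B V q" and C: "spectral d (A + B) W r"
begin

text \<open>The diagonal entries of \<open>A\<close>, \<open>B\<close> and \<open>A + B\<close> in
  the eigenbasis of \<open>A + B\<close>.\<close>

lemma overlap_sum_marginal:
  assumes k: "k < d"
  shows "(\<Sum>i<d. overlap U W i k * p i) + (\<Sum>i<d. overlap V W i k * q i) = r k"
proof -
  note c = spectral_carrier[OF A] spectral_carrier[OF B] spectral_U(2,3)[OF C]
  have "mat_adjoint W * ((A + B) * W) = mat_adjoint W * (A * W) + mat_adjoint W * (B * W)"
    by (subst add_mult_distrib_mat[of _ d d _ _ d]; (subst mult_add_distrib_mat[of _ d d _ d])?; use c in \<open>auto intro!: mult_carrier_mat\<close>)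
  then have "(mat_adjoint W * ((A + B) * W)) $$ (k, k) = (mat_adjoint W * (A * W)) $$ (k, k) + (mat_adjoint W * (B * W)) $$ (k, k)"
    using c k by (auto simp del: index_mult_mat(1))
  then show ?thesis
    using spectral_quadratic_form_self[OF C k] spectral_quadratic_form[OF A spectral_U(1)[OF C] k]
      spectral_quadratic_form[OF B spectral_U(1)[OF C] k] by simp
qed

text \<open>At a zero eigenvalue of \<open>A + B\<close> two nonnegative quadratic forms add up to
  0, so both vanish, and with them every term of their expansions.\<close>

lemma supported_summand: "supported d U p W r" "supported d V q W r"
proof -
  have nn: "0 \<le> overlap U W i k * p i" "0 \<le> overlap V W i k * q i" if "i < d" for i k
    using spectral_nonneg[OF A that] spectral_nonneg[OF B that] by simp_all
  have "(\<Sum>i<d. overlap U W i k * p i) = 0 \<and> (\<Sum>i<d. overlap V W i k * q i) = 0" if "k < d" "r k = 0" for k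
    using overlap_sum_marginal[OF that(1)] that(2) nn
      sum_nonneg[of "{..<d}" "\<lambda>i. overlap U W i k * p i"] sum_nonneg[of "{..<d}" "\<lambda>i. overlap V W i k * q i"]
    by force
  moreover have "(\<Sum>i<d. overlap U W i k * p i) = 0 \<longleftrightarrow> (\<forall>i\<in>{..<d}. overlap U W i k * p i = 0)"
    "(\<Sum>i<d. overlap V W i k * q i) = 0 \<longleftrightarrow> (\<forall>i\<in>{..<d}. overlap V W i k * q i = 0)" for k
    by (rule sum_nonneg_eq_0_iff; use nn in simp)+
  ultimately show "supported d U p W r" "supported d V q W r"
    unfolding supported_def by blast+
qed

text \<open>The two cross terms, the traces of A ln(A+B) and B ln(A+B), merge into the trace of
  (A+B) ln(A+B). The factor ln 2 converts natural to binary logarithms.\<close>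

lemma cond_ent_eq_rel_ent: "rel_ent d U p W r + rel_ent d V q W r = - ln 2 * cond_ent A B"
proof -
  have H: "vN_entropy M * ln 2 = - (\<Sum>i<d. s i * ln (s i))" if "spectral d M X s" for M X s
    unfolding vN_entropy_spectral[OF that] sum_distrib_right sum_negf[symmetric]
    using spectral_nonneg[OF that] by (intro sum.cong) (auto simp: entr_term_ln)
  have R: "rel_ent d X s W r = (\<Sum>i<d. s i * ln (s i)) - (\<Sum>k<d. (\<Sum>i<d. overlap X W i k * s i) * ln (r k))"
    if "spectral d M X s" for M X s
  proof -
    have "rel_ent d X s W r = (\<Sum>i<d. \<Sum>k<d. overlap X W i k * (s i * ln (s i))) - (\<Sum>i<d. \<Sum>k<d. overlap X W i k * s i * ln (r k))"
      by (simp add: rel_ent_def right_diff_distrib sum_subtractf mult.assoc)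
    also have "(\<Sum>i<d. \<Sum>k<d. overlap X W i k * s i * ln (r k)) = (\<Sum>k<d. (\<Sum>i<d. overlap X W i k * s i) * ln (r k))"
      by (subst sum.swap) (simp add: sum_distrib_right)
    finally show ?thesis
      using overlap_weighted_sums(1)[OF spectral_U(1)[OF that] spectral_U(1)[OF C]] by simp
  qed
  have "(\<Sum>k<d. (\<Sum>i<d. overlap U W i k * p i) * ln (r k)) + (\<Sum>k<d. (\<Sum>i<d. overlap V W i k * q i) * ln (r k))
      = (\<Sum>k<d. r k * ln (r k))"
    unfolding sum.distrib[symmetric] distrib_right[symmetric]
    by (intro sum.cong) (simp_all add: overlap_sum_marginal)
  then show ?thesis
    unfolding cond_ent_def R[OF A] R[OF B] using H[OF A] H[OF B] H[OF C] by (simp add: algebra_simps)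
qed

end

text \<open>Subadditivity of relative entropy is used once for each label, both times with the
  marginals \<open>A + B\<close> and \<open>A' + B'\<close> as second arguments.\<close>

lemma cond_ent_superadditive:
  assumes p: "psd d A" "psd d B" "psd d A'" "psd d B'"
  shows "cond_ent A B + cond_ent A' B' \<le> cond_ent (A + A') (B + B')"
proof -
  note c = p[THEN psd_carrier]
  \<comment> \<open>The total is needed in two groupings: by label, so that its kernel is controlled
    by \<open>supported_summand\<close>, and by pair, so that it is a sum of second arguments in
    \<open>rel_ent_subadditive\<close>.\<close>
  have sum: "A + A' + (B + B') = (A + B) + (A' + B')"
    by (rule eq_matI) (use c in auto)
  obtain U1 p1 where A: "spectral d A U1 p1" using psd_spectral[OF p(1)] .
  obtain U2 p2 where B: "spectral d B U2 p2" using psd_spectral[OF p(2)] .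
  obtain U3 p3 where A': "spectral d A' U3 p3" using psd_spectral[OF p(3)] .
  obtain U4 p4 where B': "spectral d B' U4 p4" using psd_spectral[OF p(4)] .
  obtain U5 p5 where AA: "spectral d (A + A') U5 p5" using psd_spectral[OF psd_add[OF p(1,3)]] .
  obtain U6 p6 where BB: "spectral d (B + B') U6 p6" using psd_spectral[OF psd_add[OF p(2,4)]] .
  obtain U7 p7 where C: "spectral d (A + B) U7 p7" using psd_spectral[OF psd_add[OF p(1,2)]] .
  obtain U8 p8 where C': "spectral d (A' + B') U8 p8" using psd_spectral[OF psd_add[OF p(3,4)]] .
  obtain U9 p9 where CC: "spectral d (A + A' + (B + B')) U9 p9"
    using psd_spectral[OF psd_add[OF psd_add[OF p(1,3)] psd_add[OF p(2,4)]]] .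
  note CC' = CC[unfolded sum]
  have "rel_ent d U5 p5 U9 p9 \<le> rel_ent d U1 p1 U7 p7 + rel_ent d U3 p3 U8 p8"
    by (rule rel_ent_subadditive[OF A C A' C' AA CC' supported_summand(1)[OF A B C]
        supported_summand(1)[OF A' B' C'] supported_summand(1)[OF AA BB CC]])
  moreover have "rel_ent d U6 p6 U9 p9 \<le> rel_ent d U2 p2 U7 p7 + rel_ent d U4 p4 U8 p8"
    by (rule rel_ent_subadditive[OF B C B' C' BB CC' supported_summand(2)[OF A B C]
        supported_summand(2)[OF A' B' C'] supported_summand(2)[OF AA BB CC]])
  ultimately have "- ln 2 * cond_ent (A + A') (B + B') \<le> - ln 2 * (cond_ent A B + cond_ent A' B')"
    using cond_ent_eq_rel_ent[OF A B C] cond_ent_eq_rel_ent[OF A' B' C'] cond_ent_eq_rel_ent[OF AA BB CC]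
    by (simp add: algebra_simps)
  then show ?thesis by simp
qed

text \<open>Conditioning cannot raise the entropy of the label above its classical value. Read
  differently, it bounds from below the entropy of a sum of two positive matrices; the continuity
  bound uses it in that form.\<close>

lemma cond_ent_le_mixing_entropy:
  assumes p: "psd d A" "psd d B"
  shows "cond_ent A B \<le> entr_term (Re (mtrace A)) + entr_term (Re (mtrace B))
    - entr_term (Re (mtrace A) + Re (mtrace B))"
proof -
  obtain U p where A: "spectral d A U p" using psd_spectral[OF p(1)] .
  obtain V q where B: "spectral d B V q" using psd_spectral[OF p(2)] .
  obtain W r where C: "spectral d (A + B) W r" using psd_spectral[OF psd_add[OF p]] .
  let ?a = "Re (mtrace A)" and ?b = "Re (mtrace B)"
  have tr: "Re (mtrace (A + B)) = ?a + ?b"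
    using mtrace_add[OF p[THEN psd_carrier]] by simp
  have low: "x * ln x - x * ln (?a + ?b) \<le> rel_ent d X s W r"
    if "spectral d M X s" "supported d X s W r" "x = Re (mtrace M)" "x \<le> ?a + ?b" for M X s x
  proof (cases "x = 0")
    case True
    have "0 \<le> s i" if "i \<in> {..<d}" for i using spectral_nonneg[OF \<open>spectral d M X s\<close>] that by auto
    moreover have "(\<Sum>i<d. s i) = 0" using True that(3) spectral_trace[OF that(1)] by simp
    ultimately have "s i = 0" if "i < d" for i
      using that sum_nonneg_eq_0_iff[of "{..<d}" s] by blast
    then show ?thesis using True by (simp add: rel_ent_def)
  next
    case False
    have "0 \<le> x"
      using spectral_trace[OF that(1)] spectral_nonneg[OF that(1)] that(3) by (auto intro!: sum_nonneg)
    with False that have pos: "0 < x" "0 < ?a + ?b" by auto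
    \<comment> \<open>The optimal scale in Klein's inequality is the ratio of the traces; it leaves
      x ln(x / (a + b)), with a and b the traces of \<open>A\<close> and \<open>B\<close>.\<close>
    have "ln (x / (?a + ?b)) * x + x - x / (?a + ?b) * (?a + ?b) \<le> rel_ent d X s W r"
      using klein_inequality[OF that(1) C that(2), of "x / (?a + ?b)"] pos
      unfolding tr that(3)[symmetric] by simp
    moreover have "x / (?a + ?b) * (?a + ?b) = x" "ln (x / (?a + ?b)) = ln x - ln (?a + ?b)"
      using pos by (simp_all add: ln_div)
    ultimately show ?thesis by (simp only:) (simp add: algebra_simps)
  qed
  have nn: "0 \<le> ?a" "0 \<le> ?b"
    using spectral_trace[OF A] spectral_nonneg[OF A] spectral_trace[OF B] spectral_nonneg[OF B]
    by (auto intro!: sum_nonneg)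
  have "?a * ln ?a + ?b * ln ?b - (?a + ?b) * ln (?a + ?b) \<le> - ln 2 * cond_ent A B"
    using low[OF A supported_summand(1)[OF A B C] refl] low[OF B supported_summand(2)[OF A B C] refl] nn
      cond_ent_eq_rel_ent[OF A B C] by (simp add: algebra_simps)
  moreover from entr_term_ln[OF nn(1)] entr_term_ln[OF nn(2)] entr_term_ln[OF add_nonneg_nonneg[OF nn]]
  have "ln 2 * (entr_term ?a + entr_term ?b - entr_term (?a + ?b))
      = (?a + ?b) * ln (?a + ?b) - ?a * ln ?a - ?b * ln ?b"
    by (simp add: algebra_simps)
  ultimately have "ln 2 * cond_ent A B \<le> ln 2 * (entr_term ?a + entr_term ?b - entr_term (?a + ?b))"
    by linarith
  then show ?thesis by simp
qed

subsection \<open>Continuity of the conditional entropy\<close>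

lemma outer_carrier [simp]:
  "u \<in> carrier_vec n \<Longrightarrow> v \<in> carrier_vec m \<Longrightarrow> outer u v \<in> carrier_mat n m"
  by (auto simp: outer_def)

lemma scalar_prod_conjugate_eq:
  assumes "(u :: complex vec) \<in> carrier_vec d" "v \<in> carrier_vec d"
  shows "u \<bullet>c v = (\<Sum>k<d. u $ k * cnj (v $ k))"
  using assms by (auto simp: scalar_prod_def lessThan_atLeast0)

lemma psd_outer:
  assumes w: "w \<in> carrier_vec d"
  shows "psd d (outer w w)"
  unfolding psd_def
proof (intro conjI ballI)
  show "outer w w \<in> carrier_mat d d" using w by simp
  show "mat_adjoint (outer w w) = outer w w"
    by (rule eq_matI) (use w in \<open>auto simp: outer_def\<close>)
  fix v :: "complex vec" assume v: "v \<in> carrier_vec d"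
  have "outer w w *\<^sub>v v = (v \<bullet>c w) \<cdot>\<^sub>v w"
  proof (rule eq_vecI)
    fix k assume "k < dim_vec ((v \<bullet>c w) \<cdot>\<^sub>v w)"
    then have "k < d" using w by simp
    then show "(outer w w *\<^sub>v v) $ k = ((v \<bullet>c w) \<cdot>\<^sub>v w) $ k"
      using w v unfolding scalar_prod_conjugate_eq[OF v w]
      by (auto simp: outer_def scalar_prod_def lessThan_atLeast0 sum_distrib_right intro!: sum.cong)
  qed (use w in \<open>simp add: outer_def\<close>)
  then have "(outer w w *\<^sub>v v) \<bullet>c v = (v \<bullet>c w) * (w \<bullet>c v)"
    using w v by simp
  also have "w \<bullet>c v = cnj (v \<bullet>c w)"
    unfolding scalar_prod_conjugate_eq[OF v w] scalar_prod_conjugate_eq[OF w v] by (simp add: mult.commute)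
  finally show "0 \<le> Re ((outer w w *\<^sub>v v) \<bullet>c v)"
    by (simp add: complex_mult_cnj)
qed

lemma mtrace_outer:
  assumes "w \<in> carrier_vec d"
  shows "mtrace (outer w w) = w \<bullet>c w"
  using assms by (auto simp: scalar_prod_conjugate_eq mtrace_def outer_def)

lemma vN_entropy_zero: "vN_entropy (0\<^sub>m d d) = 0"
proof -
  have "rdiag d (\<lambda>_. 0) = 0\<^sub>m d d" by (rule eq_matI) (auto simp: rdiag_def)
  then have "spectral d (0\<^sub>m d d) (1\<^sub>m d) (\<lambda>_. 0)"
    by (auto simp: spectral_def intro!: unitary_matI)
  from vN_entropy_spectral[OF this] show ?thesis by (simp add: entr_term_def)
qed

lemma psd_zero: "psd d (0\<^sub>m d d)"
proof -
  have "outer (0\<^sub>v d) (0\<^sub>v d) = 0\<^sub>m d d" by (rule eq_matI) (auto simp: outer_def)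
  then show ?thesis using psd_outer[of "0\<^sub>v d" d] by simp
qed

text \<open>Superadditivity for the pairs \<open>A\<close>, 0 and 0, \<open>B\<close>: in each the
  label is certain, so both conditional entropies are 0.\<close>

lemma cond_ent_nonneg:
  assumes "psd d A" "psd d B"
  shows "0 \<le> cond_ent A B"
proof -
  have "cond_ent A (0\<^sub>m d d) + cond_ent (0\<^sub>m d d) B \<le> cond_ent (A + 0\<^sub>m d d) (0\<^sub>m d d + B)"
    by (rule cond_ent_superadditive[OF assms(1) psd_zero psd_zero assms(2)])
  then show ?thesis
    using assms[THEN psd_carrier] by (simp add: cond_ent_def vN_entropy_zero)
qed

lemma mtrace_psd_nonneg:
  assumes "psd d A"
  shows "0 \<le> Re (mtrace A)"
proof -
  obtain U p where "spectral d A U p" using psd_spectral[OF assms] .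
  from spectral_trace[OF this] spectral_nonneg[OF this] show ?thesis by (auto intro!: sum_nonneg)
qed

text \<open>Binary logarithms give the correction -2 p for each eigenvalue. The resulting trace
  terms cancel in \<open>cond_ent\<close>, which is therefore homogeneous under doubling.\<close>

lemma vN_entropy_double:
  assumes "psd d A"
  shows "vN_entropy (A + A) = 2 * vN_entropy A - 2 * Re (mtrace A)"
proof -
  obtain U p where A: "spectral d A U p" using psd_spectral[OF assms] .
  note U = spectral_U[OF A]
  have "A + A = U * (rdiag d p + rdiag d p) * mat_adjoint U"
    unfolding spectral_eq[OF A]
    by (subst mult_add_distrib_mat[of _ d d _ d]; (subst add_mult_distrib_mat[of _ d d _ _ d])?; use U in \<open>auto intro!: mult_carrier_mat\<close>)
  moreover have "rdiag d p + rdiag d p = rdiag d (\<lambda>i. 2 * p i)"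
    by (rule eq_matI) (auto simp: rdiag_def)
  ultimately have AA: "spectral d (A + A) U (\<lambda>i. 2 * p i)"
    using A by (auto simp: spectral_def)
  have "entr_term (2 * p i) = 2 * entr_term (p i) - 2 * p i" if "i < d" for i
    using spectral_nonneg[OF A that] by (auto simp: entr_term_def log_mult algebra_simps)
  then show ?thesis
    unfolding vN_entropy_spectral[OF A] vN_entropy_spectral[OF AA] spectral_trace[OF A]
    by (simp add: sum_subtractf sum_distrib_left)
qed

lemma cond_ent_double:
  assumes "psd d A" "psd d B"
  shows "cond_ent (A + A) (B + B) = 2 * cond_ent A B"
proof -
  note c = assms[THEN psd_carrier]
  have "A + A + (B + B) = (A + B) + (A + B)" by (rule eq_matI) (use c in auto)
  then show ?thesis
    using vN_entropy_double[OF assms(1)] vN_entropy_double[OF assms(2)] vN_entropy_double[OF psd_add[OF assms]]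
      mtrace_add[OF c] by (simp add: cond_ent_def)
qed

text \<open>The unnormalised form of "a bit has entropy at most 1": \<open>key\<close> compares each
  weight with half of the total through ln y <= y - 1 at y = t / (2 x).\<close>

lemma entr_term_mixing_le:
  assumes "0 \<le> a" "0 \<le> b"
  shows "entr_term a + entr_term b - entr_term (a + b) \<le> a + b"
proof (cases "a + b = 0")
  case False
  define t where "t = a + b"
  have t: "0 < t" using False assms by (auto simp: t_def)
  have key: "x * ln t - x * ln 2 - x * ln x \<le> t / 2 - x" if "0 \<le> x" for x
  proof (cases "x = 0")
    case False
    then have x: "0 < x" using that by simp
    have "ln (t / (2 * x)) \<le> t / (2 * x) - 1" using x t by (intro ln_le_minus_one) auto
    then have "x * (ln t - (ln 2 + ln x)) \<le> x * (t / (2 * x) - 1)"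
      using x t by (intro mult_left_mono) (auto simp: ln_div ln_mult)
    then show ?thesis using x by (simp add: algebra_simps)
  qed (use t in simp)
  have "ln 2 * (entr_term a + entr_term b - entr_term t) \<le> ln 2 * t"
    using key[OF assms(1)] key[OF assms(2)] entr_term_ln[OF assms(1)] entr_term_ln[OF assms(2)] entr_term_ln[of t] t
    by (simp add: t_def algebra_simps)
  then show ?thesis by (simp add: t_def)
qed (use assms in \<open>simp add: entr_term_def\<close>)

lemma cond_ent_le_trace:
  assumes "psd d A" "psd d B"
  shows "cond_ent A B \<le> Re (mtrace A) + Re (mtrace B)"
  using cond_ent_le_mixing_entropy[OF assms] entr_term_mixing_le[of "Re (mtrace A)" "Re (mtrace B)"]
    assms[THEN mtrace_psd_nonneg] by linarith

text \<open>The weights 1 and \<epsilon> are 1 + \<epsilon> times a probability distribution, and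
  rescaling by the total turns the left side into its binary entropy.\<close>

lemma entr_term_mixing_bin_entropy:
  assumes "0 \<le> \<epsilon>"
  shows "entr_term 1 + entr_term \<epsilon> - entr_term (1 + \<epsilon>) = (1 + \<epsilon>) * bin_entropy (\<epsilon> / (1 + \<epsilon>))"
proof (cases "\<epsilon> = 0")
  case False
  with assms have e: "0 < \<epsilon>" by simp
  define t where "t = 1 + \<epsilon>"
  have t: "0 < t" "1 - \<epsilon> / t = 1 / t" "\<epsilon> = t - 1" using e by (simp_all add: t_def field_simps)
  have scaled: "t * entr_term (x / t) = x * (log 2 t - log 2 x)" if "0 < x" for x
  proof -
    have "\<not> x / t \<le> 0" using that t by (simp add: not_le)
    then have "entr_term (x / t) = - (x / t) * (log 2 x - log 2 t)"
      using that t(1) by (simp only: entr_term_def if_False) (simp add: log_divide)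
    then show ?thesis using t(1) by (simp only:) (simp add: right_diff_distrib)
  qed
  have "entr_term t = - t * log 2 t" "entr_term \<epsilon> = - \<epsilon> * log 2 \<epsilon>" "entr_term 1 = 0"
    using e t(1) by (simp_all add: entr_term_def)
  moreover have "t * entr_term (1 / t) = log 2 t" using scaled[of 1] by simp
  moreover have "t * log 2 t = log 2 t + \<epsilon> * log 2 t" by (simp add: t_def distrib_right)
  moreover have "\<epsilon> * (log 2 t - log 2 \<epsilon>) = \<epsilon> * log 2 t - \<epsilon> * log 2 \<epsilon>" by (rule right_diff_distrib)
  ultimately show ?thesis
    unfolding t_def[symmetric] bin_entropy_def t(2) distrib_left scaled[OF e] by linarith
qed (simp add: entr_term_def bin_entropy_def)

text \<open>The Alicki--Fannes--Winter argument: both pairs are dominated by the common pair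
  \<open>T a + N a = T' a + P a\<close>.\<close>

lemma cond_ent_continuity:
  assumes psd: "psd d T0" "psd d T1" "psd d T0'" "psd d T1'" "psd d P0" "psd d P1" "psd d N0" "psd d N1"
    and eq: "T0' + P0 = T0 + N0" "T1' + P1 = T1 + N1"
    and tr: "Re (mtrace T0') + Re (mtrace T1') = 1" "Re (mtrace P0) + Re (mtrace P1) = \<epsilon>"
  shows "cond_ent T0 T1 \<le> cond_ent T0' T1' + \<epsilon> + (1 + \<epsilon>) * bin_entropy (\<epsilon> / (1 + \<epsilon>))"
proof -
  note c = psd[THEN psd_carrier]
  have e: "0 \<le> \<epsilon>" using tr(2) psd(5,6)[THEN mtrace_psd_nonneg] by simp
  \<comment> \<open>Superadditivity gives the upper bound by the dominating pair, since the
    contribution of the \<open>N\<close> pair is nonnegative.\<close>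
  have "cond_ent T0 T1 \<le> cond_ent T0 T1 + cond_ent N0 N1"
    using cond_ent_nonneg[OF psd(7,8)] by simp
  also have "\<dots> \<le> cond_ent (T0' + P0) (T1' + P1)"
    unfolding eq by (rule cond_ent_superadditive[OF psd(1,2,7,8)])
  finally have 1: "cond_ent T0 T1 \<le> cond_ent (T0' + P0) (T1' + P1)" .
  have "T0' + P0 + (T1' + P1) = (T0' + T1') + (P0 + P1)"
    by (rule eq_matI) (use c in auto)
  moreover have "Re (mtrace (T0' + T1')) = 1" "Re (mtrace (P0 + P1)) = \<epsilon>"
    using mtrace_add c tr by auto
  \<comment> \<open>Here \<open>cond_ent\<close> is also applied to a block and its perturbation as
    if they were the two labels: its nonnegativity bounds the entropy of each sum
    \<open>T' + P\<close> from above, and the mixing bound handles the total from below. Only the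
    total costs a mixing term, of weights 1 and \<epsilon>.\<close>
  ultimately have "cond_ent (T0' + P0) (T1' + P1)
    \<le> cond_ent T0' T1' + cond_ent P0 P1 + entr_term 1 + entr_term \<epsilon> - entr_term (1 + \<epsilon>)"
    using cond_ent_le_mixing_entropy[OF psd_add[OF psd(3,4)] psd_add[OF psd(5,6)]]
      cond_ent_nonneg[OF psd(3,5)] cond_ent_nonneg[OF psd(4,6)]
    by (simp add: cond_ent_def)
  then show ?thesis
    using 1 cond_ent_le_trace[OF psd(5,6)] tr(2) entr_term_mixing_bin_entropy[OF e] by linarith
qed

subsection \<open>Tensor products and blocks\<close>

lemma sum_lessThan_2: "(\<Sum>i<2. f i) = f 0 + f (1 :: nat)"
  and sum_lessThan_4: "(\<Sum>i<4. f i) = f 0 + f 1 + (f 2 + f (3 :: nat))"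
  for f :: "nat \<Rightarrow> 'a :: comm_monoid_add"
  by (simp_all add: eval_nat_numeral add.assoc)

lemma sum_lessThan_mult:
  fixes f :: "nat \<Rightarrow> 'a :: comm_monoid_add"
  shows "sum f {..<n * m} = (\<Sum>i<n. \<Sum>j<m. f (i * m + j))"
proof (induction n)
  case (Suc n)
  have "sum f {..<Suc n * m} = sum f {..<n * m} + sum f {n * m..<n * m + m}"
    by (simp add: lessThan_atLeast0 sum.atLeastLessThan_concat add.commute)
  also have "sum f {n * m..<n * m + m} = (\<Sum>j<m. f (n * m + j))"
    using sum.shift_bounds_nat_ivl[of f 0 "n * m" m] by (simp add: lessThan_atLeast0 add.commute)
  finally show ?case using Suc by simp
qed simp

lemma index_pair_less:
  fixes i k n m :: nat
  assumes "i < n" "k < m"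
  shows "i * m + k < n * m"
proof -
  have "i * m + k < Suc i * m" using assms by simp
  also have "\<dots> \<le> n * m" using assms by (intro mult_le_mono1) simp
  finally show ?thesis .
qed

lemma index_div_less: "(i :: nat) < n * m \<Longrightarrow> i div m < n"
  by (simp add: less_mult_imp_div_less)

lemma index_mod_less: "(i :: nat) < n * m \<Longrightarrow> i mod m < m"
  by (metis mod_less_divisor gr_zeroI mult_0_right not_less_zero)

lemma tensor_vec_carrier:
  "u \<in> carrier_vec n \<Longrightarrow> v \<in> carrier_vec m \<Longrightarrow> tensor_vec u v \<in> carrier_vec (n * m)"
  by (auto simp: tensor_vec_def)

lemma tensor_vec_index:
  assumes "u \<in> carrier_vec n" "v \<in> carrier_vec m" "i < n" "k < m"
  shows "tensor_vec u v $ (i * m + k) = u $ i * v $ k"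
  using assms index_pair_less[OF assms(3,4)] by (simp add: tensor_vec_def)

lemma kron_carrier:
  "A \<in> carrier_mat n n' \<Longrightarrow> B \<in> carrier_mat m m' \<Longrightarrow> kron A B \<in> carrier_mat (n * m) (n' * m')"
  by (auto simp: kron_def)

lemma kron_mult_tensor_vec:
  assumes A: "A \<in> carrier_mat n n'" and B: "B \<in> carrier_mat m m'"
    and u: "u \<in> carrier_vec n'" and v: "v \<in> carrier_vec m'"
  shows "kron A B *\<^sub>v tensor_vec u v = tensor_vec (A *\<^sub>v u) (B *\<^sub>v v)"
proof (rule eq_vecI)
  have dims: "dim_vec (tensor_vec (A *\<^sub>v u) (B *\<^sub>v v)) = n * m" using A B by (simp add: tensor_vec_def)
  then show "dim_vec (kron A B *\<^sub>v tensor_vec u v) = dim_vec (tensor_vec (A *\<^sub>v u) (B *\<^sub>v v))"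
    using A B by (simp add: kron_def)
  fix I assume "I < dim_vec (tensor_vec (A *\<^sub>v u) (B *\<^sub>v v))"
  then have I: "I < n * m" using dims by simp
  note I' = index_div_less[OF I] index_mod_less[OF I]
  have "(kron A B *\<^sub>v tensor_vec u v) $ I = (\<Sum>J<n' * m'. kron A B $$ (I, J) * tensor_vec u v $ J)"
    using A B u v I by (simp add: kron_def scalar_prod_def tensor_vec_def lessThan_atLeast0)
  also have "\<dots> = (\<Sum>i<n'. \<Sum>j<m'. kron A B $$ (I, i * m' + j) * tensor_vec u v $ (i * m' + j))"
    by (rule sum_lessThan_mult)
  also have "\<dots> = (\<Sum>i<n'. \<Sum>j<m'. (A $$ (I div m, i) * u $ i) * (B $$ (I mod m, j) * v $ j))"
  proof (intro sum.cong refl)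
    fix i j assume "i \<in> {..<n'}" "j \<in> {..<m'}"
    then have ij: "i < n'" "j < m'" by auto
    then show "kron A B $$ (I, i * m' + j) * tensor_vec u v $ (i * m' + j) = (A $$ (I div m, i) * u $ i) * (B $$ (I mod m, j) * v $ j)"
      using A B I index_pair_less[OF ij] by (simp add: tensor_vec_index[OF u v ij] kron_def)
  qed
  also have "\<dots> = (A *\<^sub>v u) $ (I div m) * (B *\<^sub>v v) $ (I mod m)"
    using A B u v I' by (simp add: scalar_prod_def lessThan_atLeast0 sum_product)
  also have "\<dots> = tensor_vec (A *\<^sub>v u) (B *\<^sub>v v) $ I"
    using A B I by (simp add: tensor_vec_def)
  finally show "(kron A B *\<^sub>v tensor_vec u v) $ I = tensor_vec (A *\<^sub>v u) (B *\<^sub>v v) $ I" .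
qed

text \<open>Both groupings read the same three mixed-radix digits of the index.\<close>

lemma tensor_vec_assoc:
  assumes "u \<in> carrier_vec n" "v \<in> carrier_vec m" "w \<in> carrier_vec k"
  shows "tensor_vec (tensor_vec u v) w = tensor_vec u (tensor_vec v w)"
proof (rule eq_vecI)
  show "dim_vec (tensor_vec (tensor_vec u v) w) = dim_vec (tensor_vec u (tensor_vec v w))"
    by (simp add: tensor_vec_def)
  fix i assume "i < dim_vec (tensor_vec u (tensor_vec v w))"
  then have i: "i < n * m * k" using assms by (simp add: tensor_vec_def mult.assoc)
  then have i': "i < (n * (m * k))" by (simp add: mult.assoc)
  have "k \<noteq> 0" using i by (intro notI) simp
  then have "i div k div m = i div (m * k)" "i div k mod m = i mod (m * k) div k" "i mod k = i mod (m * k) mod k"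
    by (simp_all add: div_mult2_eq[symmetric] mult.commute[of m k] mod_mult2_eq)
  then show "tensor_vec (tensor_vec u v) w $ i = tensor_vec u (tensor_vec v w) $ i"
    using assms i i' index_div_less[OF i] index_mod_less[OF i'] by (simp add: tensor_vec_def mult.assoc)
qed

section \<open>Blocks of vectors and the state after measuring A1\<close>

definition block_vec :: "nat \<Rightarrow> complex vec \<Rightarrow> nat \<Rightarrow> complex vec" where
  "block_vec d w i = vec d (\<lambda>k. w $ (i * d + k))"

lemma block_vec_linear:
  assumes "w \<in> carrier_vec (n * d)" "w' \<in> carrier_vec (n * d)" "i < n"
  shows "block_vec d (w + w') i = block_vec d w i + block_vec d w' i"
    "block_vec d (c \<cdot>\<^sub>v w) i = c \<cdot>\<^sub>v block_vec d w i"
  using assms index_pair_less[OF assms(3)] by (auto simp: block_vec_def intro!: eq_vecI)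

text \<open>The unnormalised state of E on outcome \<open>a\<close>. The basis state
  \<open>a\<close>, \<open>b\<close> of A1 A2 has index 2 a + b, and the sum over \<open>b\<close>
  traces out A2.\<close>

definition measured_block :: "nat \<Rightarrow> complex mat \<Rightarrow> nat \<Rightarrow> complex mat" where
  "measured_block d \<rho> a = mat d d (\<lambda>(k, l). \<Sum>b<2. \<rho> $$ ((2 * a + b) * d + k, (2 * a + b) * d + l))"

lemma measured_block_carrier [simp]: "measured_block d \<rho> a \<in> carrier_mat d d"
  by (simp add: measured_block_def)

lemma measured_block_dim [simp]:
  "dim_row (measured_block d \<rho> a) = d" "dim_col (measured_block d \<rho> a) = d"
  by (simp_all add: measured_block_def)

lemma measurement_projector:
  assumes "a < 2"
  shows "kron (kron (outer (ket a) (ket a)) (1\<^sub>m 2)) (1\<^sub>m d)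
    = mat (4 * d) (4 * d) (\<lambda>(i, j). if i = j \<and> i div d div 2 = a then 1 else 0)"
proof (rule eq_matI)
  fix i j
  assume "i < dim_row (mat (4 * d) (4 * d) (\<lambda>(i, j). if i = j \<and> i div d div 2 = a then 1 else 0 :: complex))"
    "j < dim_col (mat (4 * d) (4 * d) (\<lambda>(i, j). if i = j \<and> i div d div 2 = a then 1 else 0 :: complex))"
  then have ij: "i < 4 * d" "j < 4 * d" by auto
  have d: "i div d < 4" "j div d < 4" "i mod d < d" "j mod d < d"
    using index_div_less[OF ij(1)] index_div_less[OF ij(2)] index_mod_less[OF ij(1)] index_mod_less[OF ij(2)] by auto
  then have "i div d div 2 < 2" "j div d div 2 < 2" by auto
  then have lhs: "kron (kron (outer (ket a) (ket a)) (1\<^sub>m 2)) (1\<^sub>m d) $$ (i, j)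
    = (if i div d div 2 = a \<and> j div d div 2 = a \<and> i div d mod 2 = j div d mod 2 \<and> i mod d = j mod d then 1 else 0)"
    using ij d assms by (auto simp: kron_def outer_def ket_def)
  have "i = j \<longleftrightarrow> i div d = j div d \<and> i mod d = j mod d" by (metis div_mult_mod_eq)
  moreover have "i div d = j div d \<longleftrightarrow> i div d div 2 = j div d div 2 \<and> i div d mod 2 = j div d mod 2" by (metis div_mult_mod_eq)
  ultimately show "kron (kron (outer (ket a) (ket a)) (1\<^sub>m 2)) (1\<^sub>m d) $$ (i, j)
    = mat (4 * d) (4 * d) (\<lambda>(i, j). if i = j \<and> i div d div 2 = a then 1 else 0) $$ (i, j)"
    unfolding lhs using ij by auto
qed (simp_all add: kron_def outer_def ket_def)

lemma ptrace_measurement: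
  assumes a: "a < 2" and r: "\<rho> \<in> carrier_mat (4 * d) (4 * d)"
  shows "ptrace_left 4 (kron (kron (outer (ket a) (ket a)) (1\<^sub>m 2)) (1\<^sub>m d) * \<rho>) = measured_block d \<rho> a"
proof -
  let ?P = "mat (4 * d) (4 * d) (\<lambda>(i, j). if i = j \<and> i div d div 2 = a then 1 else 0 :: complex)"
  have P: "?P \<in> carrier_mat (4 * d) (4 * d)" by simp
  have prod: "(?P * \<rho>) $$ (i, j) = (if i div d div 2 = a then \<rho> $$ (i, j) else 0)" if "i < 4 * d" "j < 4 * d" for i j
  proof -
    have "(?P * \<rho>) $$ (i, j) = (\<Sum>l<4 * d. ?P $$ (i, l) * \<rho> $$ (l, j))"
      by (rule times_mat_index[OF P r that])
    also have "\<dots> = (\<Sum>l<4 * d. if l = i then (if i div d div 2 = a then \<rho> $$ (i, j) else 0) else 0)"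
      by (rule sum.cong) (use that in auto)
    finally show ?thesis using that by simp
  qed
  have "(\<Sum>i<4. (?P * \<rho>) $$ (i * d + k, i * d + l)) = (\<Sum>b<2. \<rho> $$ ((2 * a + b) * d + k, (2 * a + b) * d + l))"
    if kl: "k < d" "l < d" for k l
  proof -
    have "(?P * \<rho>) $$ (i * d + k, i * d + l) = (if i div 2 = a then \<rho> $$ (i * d + k, i * d + l) else 0)"
      if "i < 4" for i
      using prod[OF index_pair_less[OF that kl(1)] index_pair_less[OF that kl(2)]] kl by simp
    then have "(\<Sum>i<4. (?P * \<rho>) $$ (i * d + k, i * d + l))
        = (\<Sum>i<4. if i div 2 = a then \<rho> $$ (i * d + k, i * d + l) else 0)"
      by (intro sum.cong) auto
    also have "\<dots> = (\<Sum>b<2. \<rho> $$ ((2 * a + b) * d + k, (2 * a + b) * d + l))"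
    proof -
      have "(\<Sum>i<4. if i div 2 = a then g i else 0) = (\<Sum>b<2. g (2 * a + b))" for g :: "nat \<Rightarrow> complex"
        using a unfolding sum_lessThan_4 sum_lessThan_2 by (auto dest!: less_2_cases)
      then show ?thesis .
    qed
    finally show ?thesis .
  qed
  moreover have "dim_row (?P * \<rho>) div 4 = d" by simp
  ultimately show ?thesis
    unfolding measurement_projector[OF a] ptrace_left_def Let_def measured_block_def
    by (intro eq_matI) (auto simp del: index_mult_mat(1))
qed

lemma cq_state_block:
  assumes r: "\<rho> \<in> carrier_mat (4 * d) (4 * d)"
  shows "cq_state d \<rho> = four_block_mat (measured_block d \<rho> 0) (0\<^sub>m d d) (0\<^sub>m d d) (measured_block d \<rho> 1)"
proof -
  have 1: "ptrace_left 4 (kron (kron (outer (ket 0) (ket 0)) (1\<^sub>m 2)) (1\<^sub>m d) * \<rho>) = measured_block d \<rho> 0"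
    "ptrace_left 4 (kron (kron (outer (ket 1) (ket 1)) (1\<^sub>m 2)) (1\<^sub>m d) * \<rho>) = measured_block d \<rho> 1"
    using ptrace_measurement[OF _ r, of 0] ptrace_measurement[OF _ r, of 1] by auto
  let ?M = "measured_block d \<rho>"
  have c: "?M 0 \<in> carrier_mat d d" "?M 1 \<in> carrier_mat d d" by auto
  show ?thesis
    unfolding cq_state_def 1
  proof (rule eq_matI)
    fix i j assume "i < dim_row (four_block_mat (?M 0) (0\<^sub>m d d) (0\<^sub>m d d) (?M 1))"
      "j < dim_col (four_block_mat (?M 0) (0\<^sub>m d d) (0\<^sub>m d d) (?M 1))"
    then have ij: "i < 2 * d" "j < 2 * d" using c by auto
    have dm: "n div d = (if n < d then 0 else 1)" "n mod d = (if n < d then n else n - d)" if "n < 2 * d" for n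
      using that by (auto simp: div_if mod_if)
    show "(kron (outer (ket 0) (ket 0)) (?M 0) + kron (outer (ket 1) (ket 1)) (?M 1)) $$ (i, j)
      = four_block_mat (?M 0) (0\<^sub>m d d) (0\<^sub>m d d) (?M 1) $$ (i, j)"
      using ij c by (auto simp: kron_def outer_def ket_def dm)
  qed (use c in \<open>auto simp: kron_def outer_def ket_def\<close>)
qed

lemma ptrace_block:
  assumes "A \<in> carrier_mat d d" "B \<in> carrier_mat d d"
  shows "ptrace_left 2 (four_block_mat A (0\<^sub>m d d) (0\<^sub>m d d) B) = A + B"
proof -
  have "dim_row (four_block_mat A (0\<^sub>m d d) (0\<^sub>m d d) B) div 2 = d" using assms by simp
  then show ?thesis
    unfolding ptrace_left_def Let_def
    by (intro eq_matI) (use assms in \<open>auto simp: sum_lessThan_2\<close>)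
qed

lemma vN_entropy_block:
  assumes A: "A \<in> carrier_mat d d" and B: "B \<in> carrier_mat d d"
  shows "vN_entropy (four_block_mat A (0\<^sub>m d d) (0\<^sub>m d d) B) = vN_entropy A + vN_entropy B"
proof -
  have "char_poly (four_block_mat A (0\<^sub>m d d) (0\<^sub>m d d) B) = char_poly A * char_poly B"
    by (rule char_poly_0_block[OF refl _ _ A _ B]) (use char_poly_factorized[OF A] char_poly_factorized[OF B] in auto)
  \<comment> \<open>Root multisets add up only for nonzero factors.\<close>
  moreover have "char_poly A \<noteq> 0" "char_poly B \<noteq> 0"
    using degree_monic_char_poly[OF A] degree_monic_char_poly[OF B] by auto
  ultimately show ?thesis by (simp add: vN_entropy_def proots_mult)
qed

text \<open>The classical-quantum state is block diagonal, so its entropy is the sum of the block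
  entropies, and tracing out the label adds the blocks.\<close>

lemma cond_entropy_ZE_eq:
  assumes "\<rho> \<in> carrier_mat (4 * d) (4 * d)"
  shows "cond_entropy_ZE d \<rho> = cond_ent (measured_block d \<rho> 0) (measured_block d \<rho> 1)"
  unfolding cond_entropy_ZE_def cq_state_block[OF assms] cond_ent_def
  by (simp add: ptrace_block[of _ d] vN_entropy_block[of _ d])

text \<open>The two vectors play the role of the E components for the two values of A2 at a fixed
  outcome on A1.\<close>

definition pair_mixture :: "complex vec \<Rightarrow> complex vec \<Rightarrow> complex mat" where
  "pair_mixture u v = outer u u + outer v v"

lemma psd_pair_mixture:
  "u \<in> carrier_vec d \<Longrightarrow> v \<in> carrier_vec d \<Longrightarrow> psd d (pair_mixture u v)"
  by (simp add: pair_mixture_def psd_add psd_outer)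

lemma mtrace_pair_mixture:
  "u \<in> carrier_vec d \<Longrightarrow> v \<in> carrier_vec d \<Longrightarrow> mtrace (pair_mixture u v) = u \<bullet>c u + v \<bullet>c v"
  by (simp add: pair_mixture_def mtrace_add[of _ d] mtrace_outer)

lemma measured_block_outer:
  assumes "w \<in> carrier_vec (4 * d)" "a < 2"
  shows "measured_block d (outer w w) a
    = pair_mixture (block_vec d w (2 * a)) (block_vec d w (2 * a + 1))"
  unfolding pair_mixture_def
proof (rule eq_matI)
  fix k l
  assume "k < dim_row (outer (block_vec d w (2 * a)) (block_vec d w (2 * a)) + outer (block_vec d w (2 * a + 1)) (block_vec d w (2 * a + 1)))"
    "l < dim_col (outer (block_vec d w (2 * a)) (block_vec d w (2 * a)) + outer (block_vec d w (2 * a + 1)) (block_vec d w (2 * a + 1)))"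
  then have kl: "k < d" "l < d" by (auto simp: outer_def block_vec_def)
  have "(2 * a + b) * d + k < 4 * d" "(2 * a + b) * d + l < 4 * d" if "b < 2" for b
    using index_pair_less[of "2 * a + b" 4 k d] index_pair_less[of "2 * a + b" 4 l d] kl that assms(2) by auto
  from this[of 0] this[of 1] show "measured_block d (outer w w) a $$ (k, l)
    = (outer (block_vec d w (2 * a)) (block_vec d w (2 * a)) + outer (block_vec d w (2 * a + 1)) (block_vec d w (2 * a + 1))) $$ (k, l)"
    using kl assms by (auto simp: measured_block_def outer_def block_vec_def eval_nat_numeral)
qed (auto simp: outer_def block_vec_def)

section \<open>Inner products and the action of a unitary on A2 E\<close>

lemma scalar_prod_tensor_vec:
  assumes "u \<in> carrier_vec n" "u' \<in> carrier_vec n" "v \<in> carrier_vec m" "v' \<in> carrier_vec m"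
  shows "tensor_vec u v \<bullet>c tensor_vec u' v' = (u \<bullet>c u') * (v \<bullet>c v')"
proof -
  have "tensor_vec u v \<bullet>c tensor_vec u' v'
      = (\<Sum>i<n. \<Sum>k<m. tensor_vec u v $ (i * m + k) * cnj (tensor_vec u' v' $ (i * m + k)))"
    using assms by (subst scalar_prod_conjugate_eq[of _ "n * m"]) (auto intro: tensor_vec_carrier simp: sum_lessThan_mult)
  also have "\<dots> = (\<Sum>i<n. \<Sum>k<m. (u $ i * cnj (u' $ i)) * (v $ k * cnj (v' $ k)))"
    using assms by (intro sum.cong refl) (simp add: tensor_vec_index[of _ n _ m])
  finally show ?thesis
    using assms by (simp add: scalar_prod_conjugate_eq[of _ n] scalar_prod_conjugate_eq[of _ m] sum_product)
qed

lemma scalar_prod_mat_adjoint: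
  fixes A :: "complex mat"
  assumes A: "A \<in> carrier_mat n m" and x: "x \<in> carrier_vec m" and y: "y \<in> carrier_vec n"
  shows "(A *\<^sub>v x) \<bullet>c y = x \<bullet>c (mat_adjoint A *\<^sub>v y)"
proof -
  have "(A *\<^sub>v x) \<bullet>c y = (\<Sum>i<n. \<Sum>j<m. A $$ (i, j) * x $ j * cnj (y $ i))"
    using assms by (subst scalar_prod_conjugate_eq[of _ n])
      (auto simp: scalar_prod_def lessThan_atLeast0 sum_distrib_right intro!: sum.cong)
  also have "\<dots> = (\<Sum>j<m. \<Sum>i<n. A $$ (i, j) * x $ j * cnj (y $ i))"
    by (rule sum.swap)
  also have "\<dots> = x \<bullet>c (mat_adjoint A *\<^sub>v y)"
    using assms mult_mat_vec_carrier[OF mat_adjoint_carrier[OF A] y] by (subst scalar_prod_conjugate_eq[of _ m])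
      (auto simp: scalar_prod_def lessThan_atLeast0 sum_distrib_left mult_ac intro!: sum.cong)
  finally show ?thesis .
qed

lemma unitary_scalar_prod:
  assumes V: "unitary_mat n V" and "x \<in> carrier_vec n" "y \<in> carrier_vec n"
  shows "(V *\<^sub>v x) \<bullet>c (V *\<^sub>v y) = x \<bullet>c y"
proof -
  have Vc: "V \<in> carrier_mat n n" "mat_adjoint V \<in> carrier_mat n n" using V by (auto simp: unitary_mat_def)
  have "(V *\<^sub>v x) \<bullet>c (V *\<^sub>v y) = x \<bullet>c (mat_adjoint V *\<^sub>v (V *\<^sub>v y))"
    by (rule scalar_prod_mat_adjoint) (use Vc assms in auto)
  also have "mat_adjoint V *\<^sub>v (V *\<^sub>v y) = (mat_adjoint V * V) *\<^sub>v y"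
    by (rule assoc_mult_mat_vec[symmetric]) (use Vc assms in auto)
  finally show ?thesis using V assms by (simp add: unitary_mat_def)
qed

lemma ket_carrier [simp]: "ket a \<in> carrier_vec 2"
  by (simp add: ket_def)

lemma ket_index: "a < 2 \<Longrightarrow> i < 2 \<Longrightarrow> ket a $ i = (if i = a then 1 else 0)"
  by (simp add: ket_def)

lemma ket_scalar_prod: "a < 2 \<Longrightarrow> b < 2 \<Longrightarrow> ket a \<bullet>c ket b = (if a = b then 1 else 0)"
  by (auto simp: scalar_prod_conjugate_eq[of _ 2] ket_def sum_lessThan_2)

lemma scalar_prod_ket_expansion:
  assumes "e \<in> carrier_vec d" "f \<in> carrier_vec d" "e' \<in> carrier_vec d" "f' \<in> carrier_vec d"
  shows "(tensor_vec (ket 0) e + tensor_vec (ket 1) f) \<bullet>c (tensor_vec (ket 0) e' + tensor_vec (ket 1) f')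
    = e \<bullet>c e' + f \<bullet>c f'"
proof -
  have c: "tensor_vec (ket a) v \<in> carrier_vec (2 * d)" if "v \<in> carrier_vec d" for a v
    using that by (intro tensor_vec_carrier) auto
  have dist: "(u + v) \<bullet>c (u' + v') = u \<bullet>c u' + u \<bullet>c v' + (v \<bullet>c u' + v \<bullet>c v')"
    if "u \<in> carrier_vec (2 * d)" "v \<in> carrier_vec (2 * d)" "u' \<in> carrier_vec (2 * d)" "v' \<in> carrier_vec (2 * d)"
    for u v u' v' :: "complex vec"
    using that by (simp add: scalar_prod_conjugate_eq[of _ "2 * d"] algebra_simps sum.distrib)
  show ?thesis
    unfolding dist[OF c c c c, OF assms] using assms
    by (simp add: scalar_prod_tensor_vec[of _ 2 _ _ d] ket_scalar_prod)
qed

text \<open>Regrouping the tensor product makes A1 a spectator of \<open>V\<close>.\<close>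

lemma controlled_mult_tensor_vec:
  assumes "V \<in> carrier_mat (2 * d) (2 * d)" "w \<in> carrier_vec d" "V *\<^sub>v tensor_vec (ket b) w = y"
  shows "kron (1\<^sub>m 2) V *\<^sub>v tensor_vec (tensor_vec (ket a) (ket b)) w = tensor_vec (ket a) y"
proof -
  have "tensor_vec (tensor_vec (ket a) (ket b)) w = tensor_vec (ket a) (tensor_vec (ket b) w)"
    by (rule tensor_vec_assoc[of _ 2 _ 2 _ d]) (use assms in auto)
  then show ?thesis
    using kron_mult_tensor_vec[of "1\<^sub>m 2" 2 2 V "2 * d" "2 * d" "ket a" "tensor_vec (ket b) w"]
      assms tensor_vec_carrier[OF ket_carrier assms(2)] by simp
qed

lemma block_vec_tensor:
  assumes e: "e \<in> carrier_vec d" and f: "f \<in> carrier_vec d" and "a < 2" "i < 4"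
  shows "block_vec d (tensor_vec (ket a) (tensor_vec (ket 0) e + tensor_vec (ket 1) f)) i
    = (if i = 2 * a then e else if i = 2 * a + 1 then f else 0\<^sub>v d)"
proof (rule eq_vecI)
  let ?y = "tensor_vec (ket 0) e + tensor_vec (ket 1) f"
  have c: "tensor_vec (ket 0) e \<in> carrier_vec (2 * d)" "tensor_vec (ket 1) f \<in> carrier_vec (2 * d)"
    using tensor_vec_carrier[OF ket_carrier e] tensor_vec_carrier[OF ket_carrier f] by auto
  then have y: "?y \<in> carrier_vec (2 * d)" by simp
  fix k assume "k < dim_vec (if i = 2 * a then e else if i = 2 * a + 1 then f else 0\<^sub>v d)"
  then have k: "k < d" using e f by (auto split: if_splits)
  have i: "i div 2 < 2" "i mod 2 < 2" using assms by auto
  have ik: "i mod 2 * d + k < 2 * d" using index_pair_less[OF i(2) k] .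
  have "i * d + k = (i div 2 * 2 + i mod 2) * d + k" by simp
  also have "\<dots> = i div 2 * (2 * d) + (i mod 2 * d + k)" by (simp only: algebra_simps)
  finally have "block_vec d (tensor_vec (ket a) ?y) i $ k = tensor_vec (ket a) ?y $ (i div 2 * (2 * d) + (i mod 2 * d + k))"
    using k by (simp add: block_vec_def add.assoc)
  also have "\<dots> = ket a $ (i div 2) * (ket 0 $ (i mod 2) * e $ k + ket 1 $ (i mod 2) * f $ k)"
    unfolding tensor_vec_index[OF ket_carrier y i(1) ik]
    using c ik tensor_vec_index[OF ket_carrier e i(2) k, of 0] tensor_vec_index[OF ket_carrier f i(2) k, of 1] by simp
  also have "\<dots> = (if i = 2 * a then e else if i = 2 * a + 1 then f else 0\<^sub>v d) $ k"
  proof -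
    have "i div 2 = a \<longleftrightarrow> i = 2 * a \<or> i = 2 * a + 1" by auto
    moreover have "i mod 2 = 0 \<or> i mod 2 = 1" by auto
    ultimately show ?thesis using i assms(3) k by (auto simp: ket_index)
  qed
  finally show "block_vec d (tensor_vec (ket a) ?y) i $ k
    = (if i = 2 * a then e else if i = 2 * a + 1 then f else 0\<^sub>v d) $ k" .
qed (use e f in \<open>auto simp: block_vec_def\<close>)

text \<open>\<open>x i \<plusminus> y i\<close> are the blocks of two orthogonal superpositions with the same even mixture; the
  cross terms \<open>x i (y i)\<^sup>*\<close> may be rewritten as \<open>p i (q i)\<^sup>*\<close> with vectors of balanced norm.\<close>

lemma mixture_of_superpositions_bound:
  fixes x y p q :: "nat \<Rightarrow> complex vec" and \<kappa> :: complex
  defines "\<kappa> \<equiv> complex_of_real (1 / sqrt 2)"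
  assumes c: "\<And>i. i < 4 \<Longrightarrow> x i \<in> carrier_vec d" "\<And>i. i < 4 \<Longrightarrow> y i \<in> carrier_vec d"
      "\<And>i. i < 4 \<Longrightarrow> p i \<in> carrier_vec d" "\<And>i. i < 4 \<Longrightarrow> q i \<in> carrier_vec d"
    and cross: "\<And>i k l. i < 4 \<Longrightarrow> k < d \<Longrightarrow> l < d \<Longrightarrow> x i $ k * cnj (y i $ l) = p i $ k * cnj (q i $ l)"
    and orth: "(\<Sum>i<4. x i \<bullet>c y i) = 0"
    and nrm: "(\<Sum>i<4. x i \<bullet>c x i + y i \<bullet>c y i) = 2"
    and nrm': "(\<Sum>i<4. p i \<bullet>c p i + q i \<bullet>c q i) = complex_of_real (2 * \<epsilon>)"
  defines "S \<equiv> \<lambda>a. pair_mixture (\<kappa> \<cdot>\<^sub>v x (2 * a)) (\<kappa> \<cdot>\<^sub>v x (2 * a + 1)) + pair_mixture (\<kappa> \<cdot>\<^sub>v y (2 * a)) (\<kappa> \<cdot>\<^sub>v y (2 * a + 1))"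
    and "T \<equiv> \<lambda>a. pair_mixture (\<kappa> \<cdot>\<^sub>v (x (2 * a) + y (2 * a))) (\<kappa> \<cdot>\<^sub>v (x (2 * a + 1) + y (2 * a + 1)))"
  shows "cond_ent (T 0) (T 1) / 2 \<le> cond_ent (S 0) (S 1)"
    and "cond_ent (T 0) (T 1) - (\<epsilon> + (1 + \<epsilon>) * bin_entropy (\<epsilon> / (1 + \<epsilon>))) / 2 \<le> cond_ent (S 0) (S 1)"
proof -
  have kk: "\<kappa> * cnj \<kappa> = 1 / 2"
    by (simp add: \<kappa>_def complex_eq_iff)
  have kk': "\<kappa> * u * (cnj \<kappa> * v) = u * v / 2" for u v
  proof -
    have "\<kappa> * u * (cnj \<kappa> * v) = (\<kappa> * cnj \<kappa>) * (u * v)" by simp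
    then show ?thesis unfolding kk by simp
  qed
  have kk'': "\<kappa> * (cnj \<kappa> * u) = u / 2" for u
    using kk'[of 1 u] by simp
  \<comment> \<open>The blocks of the superposition with the opposite relative sign.\<close>
  define T' where "T' = (\<lambda>a. pair_mixture (\<kappa> \<cdot>\<^sub>v (x (2 * a) - y (2 * a))) (\<kappa> \<cdot>\<^sub>v (x (2 * a + 1) - y (2 * a + 1))))"
  \<comment> \<open>Polarization: \<open>P\<close> minus \<open>N\<close> is the sum of the products
    of \<open>p i\<close> with the adjoint of \<open>q i\<close>, plus adjoints. Both are positive
    by construction.\<close>
  define P where "P = (\<lambda>a. pair_mixture (\<kappa> \<cdot>\<^sub>v (p (2 * a) + q (2 * a))) (\<kappa> \<cdot>\<^sub>v (p (2 * a + 1) + q (2 * a + 1))))"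
  define N where "N = (\<lambda>a. pair_mixture (\<kappa> \<cdot>\<^sub>v (p (2 * a) - q (2 * a))) (\<kappa> \<cdot>\<^sub>v (p (2 * a + 1) - q (2 * a + 1))))"
  have psd: "psd d (S a)" "psd d (T a)" "psd d (T' a)" "psd d (P a)" "psd d (N a)" if "a < 2" for a
    unfolding S_def T_def T'_def P_def N_def using that c
    by (auto intro!: psd_pair_mixture psd_add)
  \<comment> \<open>The parallelogram identity: cross terms cancel between the two signs.\<close>
  have avg: "T a + T' a = S a + S a" if a: "a < 2" for a
  proof (rule eq_matI)
    fix k l assume "k < dim_row (S a + S a)" "l < dim_col (S a + S a)"
    then have kl: "k < d" "l < d" using psd(1)[OF a] by (auto simp: psd_def)
    have c': "x (2 * a) \<in> carrier_vec d" "x (2 * a + 1) \<in> carrier_vec d" "y (2 * a) \<in> carrier_vec d" "y (2 * a + 1) \<in> carrier_vec d"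
      using c a by auto
    have [simp]: "dim_vec (x (2 * a)) = d" "dim_vec (x (Suc (2 * a))) = d" "dim_vec (y (2 * a)) = d" "dim_vec (y (Suc (2 * a))) = d"
      using c' by auto
    show "(T a + T' a) $$ (k, l) = (S a + S a) $$ (k, l)"
      using kl by (simp add: T_def T'_def S_def pair_mixture_def outer_def kk') (simp add: field_simps)
  qed (use psd[OF a] in \<open>auto simp: psd_def\<close>)
  \<comment> \<open>\<open>T a - T' a\<close> and \<open>P a - N a\<close> consist of cross terms
    alone, and \<open>cross\<close> identifies them.\<close>
  have dom: "T' a + P a = T a + N a" if a: "a < 2" for a
  proof (rule eq_matI)
    fix k l assume "k < dim_row (T a + N a)" "l < dim_col (T a + N a)"
    then have kl: "k < d" "l < d" using psd(2,5)[OF a] by (auto simp: psd_def)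
    have lt: "2 * a < 4" "2 * a + 1 < 4" using a by auto
    have dims [simp]: "dim_vec (x (2 * a)) = d" "dim_vec (x (Suc (2 * a))) = d" "dim_vec (y (2 * a)) = d" "dim_vec (y (Suc (2 * a))) = d"
      "dim_vec (p (2 * a)) = d" "dim_vec (p (Suc (2 * a))) = d" "dim_vec (q (2 * a)) = d" "dim_vec (q (Suc (2 * a))) = d"
      using c[OF lt(1)] c[OF lt(2)] by auto
    have cr: "y i $ k * cnj (x i $ l) = q i $ k * cnj (p i $ l)" if "i < 4" for i
      using arg_cong[OF cross[OF that kl(2,1)], of cnj] by (simp add: mult.commute)
    note cr4 = cross[OF lt(1) kl] cross[OF lt(2) kl] cr[OF lt(1)] cr[OF lt(2)]
    have "(T' a + P a) $$ (k, l) - (T a + N a) $$ (k, l)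
      = p (2 * a) $ k * cnj (q (2 * a) $ l) - x (2 * a) $ k * cnj (y (2 * a) $ l)
      + (p (2 * a + 1) $ k * cnj (q (2 * a + 1) $ l) - x (2 * a + 1) $ k * cnj (y (2 * a + 1) $ l))
      + (q (2 * a) $ k * cnj (p (2 * a) $ l) - y (2 * a) $ k * cnj (x (2 * a) $ l))
      + (q (2 * a + 1) $ k * cnj (p (2 * a + 1) $ l) - y (2 * a + 1) $ k * cnj (x (2 * a + 1) $ l))"
      using kl by (simp add: T_def T'_def P_def N_def pair_mixture_def outer_def kk') (simp add: field_simps)
    also have "\<dots> = 0" unfolding cr4 by simp
    finally show "(T' a + P a) $$ (k, l) = (T a + N a) $$ (k, l)" by simp
  qed (use psd[OF a] in \<open>auto simp: psd_def\<close>)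
  have nplus: "(\<kappa> \<cdot>\<^sub>v (u + v)) \<bullet>c (\<kappa> \<cdot>\<^sub>v (u + v)) = (u \<bullet>c u + v \<bullet>c v) / 2 + (u \<bullet>c v + cnj (u \<bullet>c v)) / 2"
    and nminus: "(\<kappa> \<cdot>\<^sub>v (u - v)) \<bullet>c (\<kappa> \<cdot>\<^sub>v (u - v)) = (u \<bullet>c u + v \<bullet>c v) / 2 - (u \<bullet>c v + cnj (u \<bullet>c v)) / 2"
    if "u \<in> carrier_vec d" "v \<in> carrier_vec d" for u v
    using that
    by (simp_all add: scalar_prod_conjugate_eq[of _ d] kk'' algebra_simps sum.distrib sum_subtractf add_divide_distrib
        diff_divide_distrib sum_divide_distrib)
  \<comment> \<open>Equal rank-one products have equal traces, so \<open>orth\<close> also removes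
    the cross terms from the total trace of \<open>P\<close>.\<close>
  have pq: "p i \<bullet>c q i = x i \<bullet>c y i" if "i < 4" for i
    using c[OF that] cross[OF that] by (simp add: scalar_prod_conjugate_eq[of _ d])
  define B where "B = (\<lambda>i. x i \<bullet>c y i + cnj (x i \<bullet>c y i))"
  define A where "A = (\<lambda>i. x i \<bullet>c x i + y i \<bullet>c y i)"
  define A' where "A' = (\<lambda>i. p i \<bullet>c p i + q i \<bullet>c q i)"
  have "(\<Sum>i<4. B i) = (\<Sum>i<4. x i \<bullet>c y i) + cnj (\<Sum>i<4. x i \<bullet>c y i)"
    by (simp add: B_def sum.distrib)
  then have "(\<Sum>i<4. B i) = 0" using orth by simp
  then have sums: "B 0 + B 1 + (B 2 + B 3) = 0" "A 0 + A 1 + (A 2 + A 3) = 2"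
    "A' 0 + A' 1 + (A' 2 + A' 3) = complex_of_real (2 * \<epsilon>)"
    using nrm nrm' unfolding A_def[symmetric] A'_def[symmetric] by (simp_all add: sum_lessThan_4)
  have tr: "mtrace (T' a) = (A (2 * a) + A (2 * a + 1)) / 2 - (B (2 * a) + B (2 * a + 1)) / 2"
    "mtrace (P a) = (A' (2 * a) + A' (2 * a + 1)) / 2 + (B (2 * a) + B (2 * a + 1)) / 2" if "a < 2" for a
  proof -
    have lt: "2 * a < 4" "2 * a + 1 < 4" using that by auto
    note cs = c[OF lt(1)] c[OF lt(2)]
    have "mtrace (T' a) = (\<kappa> \<cdot>\<^sub>v (x (2 * a) - y (2 * a))) \<bullet>c (\<kappa> \<cdot>\<^sub>v (x (2 * a) - y (2 * a)))
        + (\<kappa> \<cdot>\<^sub>v (x (2 * a + 1) - y (2 * a + 1))) \<bullet>c (\<kappa> \<cdot>\<^sub>v (x (2 * a + 1) - y (2 * a + 1)))"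
      unfolding T'_def by (rule mtrace_pair_mixture[of _ d]) (use cs in auto)
    also have "\<dots> = A (2 * a) / 2 - B (2 * a) / 2 + (A (2 * a + 1) / 2 - B (2 * a + 1) / 2)"
      unfolding nminus[OF cs(1,2)] nminus[OF cs(5,6)] A_def B_def ..
    finally show "mtrace (T' a) = (A (2 * a) + A (2 * a + 1)) / 2 - (B (2 * a) + B (2 * a + 1)) / 2"
      by (simp add: add_divide_distrib)
    have "mtrace (P a) = (\<kappa> \<cdot>\<^sub>v (p (2 * a) + q (2 * a))) \<bullet>c (\<kappa> \<cdot>\<^sub>v (p (2 * a) + q (2 * a)))
        + (\<kappa> \<cdot>\<^sub>v (p (2 * a + 1) + q (2 * a + 1))) \<bullet>c (\<kappa> \<cdot>\<^sub>v (p (2 * a + 1) + q (2 * a + 1)))"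
      unfolding P_def by (rule mtrace_pair_mixture[of _ d]) (use cs in auto)
    also have "\<dots> = A' (2 * a) / 2 + B (2 * a) / 2 + (A' (2 * a + 1) / 2 + B (2 * a + 1) / 2)"
      unfolding nplus[OF cs(3,4)] nplus[OF cs(7,8)] pq[OF lt(1)] pq[OF lt(2)] A'_def B_def ..
    finally show "mtrace (P a) = (A' (2 * a) + A' (2 * a + 1)) / 2 + (B (2 * a) + B (2 * a + 1)) / 2"
      by (simp add: add_divide_distrib)
  qed
  have "mtrace (T' 0) + mtrace (T' 1) = (A 0 + A 1 + (A 2 + A 3)) / 2 - (B 0 + B 1 + (B 2 + B 3)) / 2"
    using tr(1)[of 0] tr(1)[of 1] by (simp add: add_divide_distrib numeral_3_eq_3 numeral_2_eq_2)
  then have trT': "mtrace (T' 0) + mtrace (T' 1) = 1" unfolding sums by simp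
  have "mtrace (P 0) + mtrace (P 1) = (A' 0 + A' 1 + (A' 2 + A' 3)) / 2 + (B 0 + B 1 + (B 2 + B 3)) / 2"
    using tr(2)[of 0] tr(2)[of 1] by (simp add: add_divide_distrib numeral_3_eq_3 numeral_2_eq_2)
  then have trP: "mtrace (P 0) + mtrace (P 1) = complex_of_real \<epsilon>" unfolding sums by simp
  have "cond_ent (T 0) (T 1) + cond_ent (T' 0) (T' 1) \<le> cond_ent (S 0 + S 0) (S 1 + S 1)"
    using cond_ent_superadditive[of d "T 0" "T 1" "T' 0" "T' 1"] psd avg[of 0] avg[of 1] by simp
  also have "\<dots> = 2 * cond_ent (S 0) (S 1)"
    by (rule cond_ent_double[of d]) (use psd in auto)
  finally have mix: "cond_ent (T 0) (T 1) + cond_ent (T' 0) (T' 1) \<le> 2 * cond_ent (S 0) (S 1)" .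
  have "0 \<le> cond_ent (T' 0) (T' 1)" by (rule cond_ent_nonneg[of d]) (use psd in auto)
  with mix show "cond_ent (T 0) (T 1) / 2 \<le> cond_ent (S 0) (S 1)" by simp
  have "cond_ent (T 0) (T 1) \<le> cond_ent (T' 0) (T' 1) + \<epsilon> + (1 + \<epsilon>) * bin_entropy (\<epsilon> / (1 + \<epsilon>))"
    by (rule cond_ent_continuity[of d _ _ _ _ "P 0" "P 1" "N 0" "N 1"])
      (use psd dom[of 0] dom[of 1] arg_cong[OF trT', of Re] arg_cong[OF trP, of Re] in simp_all)
  \<comment> \<open>The continuity loss affects only one of the two averaged terms, so half of it
    remains.\<close>
  moreover have "t - (e + w) / 2 \<le> m" if "t + t' \<le> 2 * m" "t \<le> t' + e + w" for t t' m e w :: real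
    using that by (simp add: field_simps)
  ultimately show "cond_ent (T 0) (T 1) - (\<epsilon> + (1 + \<epsilon>) * bin_entropy (\<epsilon> / (1 + \<epsilon>))) / 2 \<le> cond_ent (S 0) (S 1)"
    using mix by blast
qed

section \<open>Application to the attack\<close>

lemma measured_block_add:
  assumes "A \<in> carrier_mat (4 * d) (4 * d)" "B \<in> carrier_mat (4 * d) (4 * d)" "a < 2"
  shows "measured_block d (A + B) a = measured_block d A a + measured_block d B a"
proof (rule eq_matI)
  fix k l assume "k < dim_row (measured_block d A a + measured_block d B a)"
    "l < dim_col (measured_block d A a + measured_block d B a)"
  then have kl: "k < d" "l < d" by auto
  have "(2 * a + b) * d + k < 4 * d" "(2 * a + b) * d + l < 4 * d" if "b < 2" for b
    using index_pair_less[of "2 * a + b" 4 k d] index_pair_less[of "2 * a + b" 4 l d] kl that assms(3) by auto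
  then show "measured_block d (A + B) a $$ (k, l) = (measured_block d A a + measured_block d B a) $$ (k, l)"
    using kl assms by (simp add: measured_block_def sum.distrib)
qed auto

theorem theorem3:
  fixes Q :: real and \<eta> :: complex and d :: nat
    and z0 z1 :: "complex vec"  \<comment> \<open>the fixed orthonormal vectors |0>_E, |1>_E of H_E = C^d\<close>
    and V :: "complex mat"
    and e0 e1 e2 e3 f0 f1 f2 f3 :: "complex vec"
  assumes Q: "0 \<le> Q" "Q \<le> 1"
    and eta: "cmod \<eta> \<le> 1"
    and z: "z0 \<in> carrier_vec d" "z1 \<in> carrier_vec d"
           "z0 \<bullet>c z0 = 1" "z1 \<bullet>c z1 = 1" "z0 \<bullet>c z1 = 0"
    and V: "unitary_mat (2 * d) V"
    and ef: "e0 \<in> carrier_vec d" "e1 \<in> carrier_vec d" "e2 \<in> carrier_vec d" "e3 \<in> carrier_vec d"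
            "f0 \<in> carrier_vec d" "f1 \<in> carrier_vec d" "f2 \<in> carrier_vec d" "f3 \<in> carrier_vec d"
  defines "ve \<equiv> \<eta> \<cdot>\<^sub>v z0 + complex_of_real (sqrt (1 - (cmod \<eta>)\<^sup>2)) \<cdot>\<^sub>v z1"
    and "vf \<equiv> (- cnj \<eta>) \<cdot>\<^sub>v z0 + complex_of_real (sqrt (1 - (cmod \<eta>)\<^sup>2)) \<cdot>\<^sub>v z1"
  assumes Ve: "V *\<^sub>v tensor_vec (ket 0) z0 = tensor_vec (ket 0) e0 + tensor_vec (ket 1) e1"
              "V *\<^sub>v tensor_vec (ket 1) z0 = tensor_vec (ket 0) e2 + tensor_vec (ket 1) e3"
              "V *\<^sub>v tensor_vec (ket 0) vf = tensor_vec (ket 0) f0 + tensor_vec (ket 1) f1"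
              "V *\<^sub>v tensor_vec (ket 1) ve = tensor_vec (ket 0) f2 + tensor_vec (ket 1) f3"
    and norms: "e0 \<bullet>c e0 = complex_of_real (1 - Q)" "e3 \<bullet>c e3 = complex_of_real (1 - Q)"
               "f0 \<bullet>c f0 = complex_of_real (1 - Q)" "f3 \<bullet>c f3 = complex_of_real (1 - Q)"
               "e1 \<bullet>c e1 = complex_of_real Q" "e2 \<bullet>c e2 = complex_of_real Q"
               "f1 \<bullet>c f1 = complex_of_real Q" "f2 \<bullet>c f2 = complex_of_real Q"
  defines "Rw00 \<equiv> complex_of_real (sqrt (1 - Q)) \<cdot>\<^sub>v tensor_vec (tensor_vec (ket 0) (ket 0)) z0
                 + complex_of_real (sqrt Q) \<cdot>\<^sub>v tensor_vec (tensor_vec (ket 1) (ket 0)) vf"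
    and "Rw11 \<equiv> complex_of_real (sqrt Q) \<cdot>\<^sub>v tensor_vec (tensor_vec (ket 0) (ket 1)) ve
                 + complex_of_real (sqrt (1 - Q)) \<cdot>\<^sub>v tensor_vec (tensor_vec (ket 1) (ket 1)) z0"
  defines "W00 \<equiv> kron (1\<^sub>m 2) V *\<^sub>v Rw00"
  defines "W11 \<equiv> kron (1\<^sub>m 2) V *\<^sub>v Rw11"
  defines "WPhi \<equiv> complex_of_real (1 / sqrt 2) \<cdot>\<^sub>v (W00 + W11)"
  defines "\<tau> \<equiv> outer WPhi WPhi"
  defines "\<sigma> \<equiv> (1/2 :: complex) \<cdot>\<^sub>m outer W00 W00 + (1/2 :: complex) \<cdot>\<^sub>m outer W11 W11"
    and "\<delta> \<equiv> 2 * Q * (1 - Q) + (1/2 + 2 * Q * (1 - Q))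
                 * bin_entropy (4 * Q * (1 - Q) / (1 + 4 * Q * (1 - Q)))"
  defines "fQ \<equiv> (if cond_entropy_ZE d \<tau> \<ge> 2 * \<delta> then cond_entropy_ZE d \<tau> - \<delta>
              else cond_entropy_ZE d \<tau> / 2)"
  shows "cond_entropy_ZE d \<sigma> \<ge> fQ"
proof -
  define s where "s = complex_of_real (sqrt (1 - Q))"
  define r where "r = complex_of_real (sqrt Q)"
  define \<kappa> where "\<kappa> = complex_of_real (1 / sqrt 2)"
  have real: "cnj s = s" "cnj r = r" "cnj \<kappa> = \<kappa>" by (simp_all add: s_def r_def \<kappa>_def)
  have ss: "s * (s * w) = complex_of_real (1 - Q) * w" "r * (r * w) = complex_of_real Q * w" for w
    unfolding mult.assoc[symmetric] using Q by (simp_all add: s_def r_def of_real_mult[symmetric] del: of_real_mult of_real_diff)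
  have kk: "\<kappa> * \<kappa> = 1 / 2"
    by (simp add: \<kappa>_def complex_eq_iff)
  have Vc: "V \<in> carrier_mat (2 * d) (2 * d)" using V by (rule unitary_mat_carrier)
  have vc: "ve \<in> carrier_vec d" "vf \<in> carrier_vec d" using z by (simp_all add: ve_def vf_def)
  have tc: "tensor_vec (ket a) v \<in> carrier_vec (2 * d)" if "v \<in> carrier_vec d" for a v
    using tensor_vec_carrier[OF ket_carrier that] .
  have tc4: "tensor_vec (tensor_vec (ket a) (ket b)) v \<in> carrier_vec (4 * d)" if "v \<in> carrier_vec d" for a b v
    using tensor_vec_carrier[OF tensor_vec_carrier[OF ket_carrier ket_carrier] that, of a b] by simp
  have kV: "kron (1\<^sub>m 2) V \<in> carrier_mat (4 * d) (4 * d)"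
    using kron_carrier[OF one_carrier_mat Vc, of 2] by (simp add: mult.assoc[symmetric])
  define E where "E = (\<lambda>a e f. tensor_vec (ket a) (tensor_vec (ket 0) e + tensor_vec (ket 1) f))"
  have Ec: "E a e f \<in> carrier_vec (4 * d)" if "e \<in> carrier_vec d" "f \<in> carrier_vec d" for a e f
    using tensor_vec_carrier[OF ket_carrier add_carrier_vec[OF tc tc], OF that, of a 0 1] by (simp add: E_def mult.assoc[symmetric])
  note step = controlled_mult_tensor_vec[OF Vc z(1) Ve(1), of 0] controlled_mult_tensor_vec[OF Vc vc(2) Ve(3), of 1]
    controlled_mult_tensor_vec[OF Vc vc(1) Ve(4), of 0] controlled_mult_tensor_vec[OF Vc z(1) Ve(2), of 1]
  have W00: "W00 = s \<cdot>\<^sub>v E 0 e0 e1 + r \<cdot>\<^sub>v E 1 f0 f1"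
    unfolding W00_def Rw00_def s_def[symmetric] r_def[symmetric] E_def step(1,2)[symmetric]
    using kV tc4[OF z(1)] tc4[OF vc(2)] by (simp add: mult_add_distrib_mat_vec[of _ "4 * d" "4 * d"] mult_mat_vec[of _ "4 * d" "4 * d"])
  have W11: "W11 = r \<cdot>\<^sub>v E 0 f2 f3 + s \<cdot>\<^sub>v E 1 e2 e3"
    unfolding W11_def Rw11_def s_def[symmetric] r_def[symmetric] E_def step(3,4)[symmetric]
    using kV tc4[OF z(1)] tc4[OF vc(1)] by (simp add: mult_add_distrib_mat_vec[of _ "4 * d" "4 * d"] mult_mat_vec[of _ "4 * d" "4 * d"])
  \<comment> \<open>The E components of \<open>W00\<close>, and below those of \<open>W11\<close>,
    indexed by the basis state 2 a + b of A1 A2; the weights \<open>s\<close> and \<open>r\<close>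
    come from the isometry.\<close>
  define x where "x = (\<lambda>i :: nat. if i = 0 then s \<cdot>\<^sub>v e0 else if i = 1 then s \<cdot>\<^sub>v e1 else if i = 2 then r \<cdot>\<^sub>v f0 else r \<cdot>\<^sub>v f1)"
  define y where "y = (\<lambda>i :: nat. if i = 0 then r \<cdot>\<^sub>v f2 else if i = 1 then r \<cdot>\<^sub>v f3 else if i = 2 then s \<cdot>\<^sub>v e2 else s \<cdot>\<^sub>v e3)"
  \<comment> \<open>Exchanging the weights of the first and last pair gives all eight vectors the squared norm \<open>Q (1 - Q)\<close>.\<close>
  define p where "p = (\<lambda>i :: nat. if i = 0 then r \<cdot>\<^sub>v e0 else if i = 1 then s \<cdot>\<^sub>v e1 else if i = 2 then r \<cdot>\<^sub>v f0 else s \<cdot>\<^sub>v f1)"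
  define q where "q = (\<lambda>i :: nat. if i = 0 then s \<cdot>\<^sub>v f2 else if i = 1 then r \<cdot>\<^sub>v f3 else if i = 2 then s \<cdot>\<^sub>v e2 else r \<cdot>\<^sub>v e3)"
  have c: "x i \<in> carrier_vec d" "y i \<in> carrier_vec d" "p i \<in> carrier_vec d" "q i \<in> carrier_vec d" for i
    using ef by (simp_all add: x_def y_def p_def q_def)
  have Wc: "W00 \<in> carrier_vec (4 * d)" "W11 \<in> carrier_vec (4 * d)"
    unfolding W00 W11 using Ec ef by simp_all
  have Eb: "block_vec d (E a e f) i = (if i = 2 * a then e else if i = 2 * a + 1 then f else 0\<^sub>v d)"
    if "e \<in> carrier_vec d" "f \<in> carrier_vec d" "a < 2" "i < 4" for a e f i
    unfolding E_def using block_vec_tensor[OF that] .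
  have i4: "i = 0 \<or> i = 1 \<or> i = 2 \<or> i = 3" if "i < 4" for i :: nat using that by auto
  have lin: "block_vec d (b \<cdot>\<^sub>v w + b' \<cdot>\<^sub>v w') i = b \<cdot>\<^sub>v block_vec d w i + b' \<cdot>\<^sub>v block_vec d w' i"
    if "w \<in> carrier_vec (4 * d)" "w' \<in> carrier_vec (4 * d)" "i < 4" for b b' w w' i
    using block_vec_linear[of "b \<cdot>\<^sub>v w" 4 d "b' \<cdot>\<^sub>v w'" i] block_vec_linear(2)[OF that(1,1,3)] block_vec_linear(2)[OF that(2,2,3)] that
    by simp
  have bW: "block_vec d W00 i = x i" "block_vec d W11 i = y i" if i: "i < 4" for i
    unfolding W00 W11 lin[OF Ec Ec i, OF ef(1,2,5,6)] lin[OF Ec Ec i, OF ef(7,8,3,4)]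
    using i4[OF i] ef by (auto simp: Eb x_def y_def)
  have bk: "block_vec d (\<kappa> \<cdot>\<^sub>v w) i = \<kappa> \<cdot>\<^sub>v block_vec d w i" if "w \<in> carrier_vec (4 * d)" "i < 4" for w i
    using block_vec_linear(2)[OF that(1,1,2)] .
  \<comment> \<open>\<open>V\<close> preserves the orthogonality of vectors with different A2 basis
    states. The two relations cover the outcomes 0 and 1 of A1.\<close>
  have ortho: "e0 \<bullet>c f2 + e1 \<bullet>c f3 = 0" "f0 \<bullet>c e2 + f1 \<bullet>c e3 = 0"
  proof -
    have "tensor_vec (ket 0) u \<bullet>c tensor_vec (ket 1) v = 0" if "u \<in> carrier_vec d" "v \<in> carrier_vec d" for u v
      using that by (simp add: scalar_prod_tensor_vec[of _ 2 _ _ d] ket_scalar_prod)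
    then have "(V *\<^sub>v tensor_vec (ket 0) u) \<bullet>c (V *\<^sub>v tensor_vec (ket 1) v) = 0"
      if "u \<in> carrier_vec d" "v \<in> carrier_vec d" for u v
      using that unitary_scalar_prod[OF V tc tc] by simp
    from this[OF z(1) vc(1)] this[OF vc(2) z(1)]
    show "e0 \<bullet>c f2 + e1 \<bullet>c f3 = 0" "f0 \<bullet>c e2 + f1 \<bullet>c e3 = 0"
      unfolding Ve scalar_prod_ket_expansion[OF ef(1,2,7,8)] scalar_prod_ket_expansion[OF ef(5,6,3,4)] .
  qed
  have sp: "u \<bullet>c (b \<cdot>\<^sub>v v) = cnj b * (u \<bullet>c v)" if "u \<in> carrier_vec d" "v \<in> carrier_vec d" for b u v
    using that by (simp add: scalar_prod_conjugate_eq[of _ d] sum_distrib_left mult_ac)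
  have orth: "(\<Sum>i<4. x i \<bullet>c y i) = 0"
  proof -
    have "(\<Sum>i<4. x i \<bullet>c y i) = s * r * (e0 \<bullet>c f2 + e1 \<bullet>c f3) + s * r * (f0 \<bullet>c e2 + f1 \<bullet>c e3)"
      using ef by (simp add: sum_lessThan_4 x_def y_def sp real algebra_simps)
    then show ?thesis unfolding ortho by simp
  qed
  have nrm: "(\<Sum>i<4. x i \<bullet>c x i + y i \<bullet>c y i) = 2"
    using ef by (simp add: sum_lessThan_4 x_def y_def sp real ss norms) (simp add: algebra_simps)
  have nrm': "(\<Sum>i<4. p i \<bullet>c p i + q i \<bullet>c q i) = complex_of_real (2 * (4 * Q * (1 - Q)))"
    using ef by (simp add: sum_lessThan_4 p_def q_def sp real ss norms)
  have cross: "x i $ k * cnj (y i $ l) = p i $ k * cnj (q i $ l)" if "i < 4" "k < d" "l < d" for i k l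
    using i4[OF that(1)] ef that by (auto simp: x_def y_def p_def q_def real)
  have tau: "measured_block d \<tau> a = pair_mixture (\<kappa> \<cdot>\<^sub>v (x (2 * a) + y (2 * a))) (\<kappa> \<cdot>\<^sub>v (x (2 * a + 1) + y (2 * a + 1)))"
    if "a < 2" for a
  proof -
    have lt: "2 * a < 4" "2 * a + 1 < 4" using that by auto
    have WP: "WPhi = \<kappa> \<cdot>\<^sub>v (W00 + W11)" by (simp add: WPhi_def \<kappa>_def)
    have "block_vec d WPhi i = \<kappa> \<cdot>\<^sub>v (x i + y i)" if "i < 4" for i
      unfolding WP using bk[OF add_carrier_vec[OF Wc] that] block_vec_linear(1)[OF Wc that] bW[OF that] by simp
    from this[OF lt(1)] this[OF lt(2)] show ?thesis
      using measured_block_outer[OF _ that, of WPhi] Wc by (simp add: \<tau>_def WP)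
  qed
  have sigma: "measured_block d \<sigma> a = pair_mixture (\<kappa> \<cdot>\<^sub>v x (2 * a)) (\<kappa> \<cdot>\<^sub>v x (2 * a + 1)) + pair_mixture (\<kappa> \<cdot>\<^sub>v y (2 * a)) (\<kappa> \<cdot>\<^sub>v y (2 * a + 1))"
    if "a < 2" for a
  proof -
    have lt: "2 * a < 4" "2 * a + 1 < 4" using that by auto
    \<comment> \<open>The probability 1/2 is absorbed into the vector as \<kappa>, so that \<sigma>
      gets the same form as \<tau>.\<close>
    have half: "(1 / 2) \<cdot>\<^sub>m outer w w = outer (\<kappa> \<cdot>\<^sub>v w) (\<kappa> \<cdot>\<^sub>v w)" for w
    proof (rule eq_matI)
      fix i j assume "i < dim_row (outer (\<kappa> \<cdot>\<^sub>v w) (\<kappa> \<cdot>\<^sub>v w))" "j < dim_col (outer (\<kappa> \<cdot>\<^sub>v w) (\<kappa> \<cdot>\<^sub>v w))"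
      moreover have "1 / 2 * (w $ i * cnj (w $ j)) = \<kappa> * w $ i * (\<kappa> * cnj (w $ j))"
        unfolding kk[symmetric] by (simp only: mult_ac)
      ultimately show "((1 / 2) \<cdot>\<^sub>m outer w w) $$ (i, j) = outer (\<kappa> \<cdot>\<^sub>v w) (\<kappa> \<cdot>\<^sub>v w) $$ (i, j)"
        by (simp add: outer_def real)
    qed (simp_all add: outer_def)
    have kc: "\<kappa> \<cdot>\<^sub>v W00 \<in> carrier_vec (4 * d)" "\<kappa> \<cdot>\<^sub>v W11 \<in> carrier_vec (4 * d)" using Wc by simp_all
    show ?thesis
      unfolding \<sigma>_def half measured_block_add[OF outer_carrier[OF kc(1,1)] outer_carrier[OF kc(2,2)] that]
        measured_block_outer[OF kc(1) that] measured_block_outer[OF kc(2) that]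
        bk[OF Wc(1) lt(1)] bk[OF Wc(1) lt(2)] bk[OF Wc(2) lt(1)] bk[OF Wc(2) lt(2)]
        bW[OF lt(1)] bW[OF lt(2)] ..
  qed
  have "\<tau> \<in> carrier_mat (4 * d) (4 * d)" "\<sigma> \<in> carrier_mat (4 * d) (4 * d)"
    using Wc by (simp_all add: \<tau>_def WPhi_def \<sigma>_def)
  then have ent: "cond_entropy_ZE d \<tau> = cond_ent (measured_block d \<tau> 0) (measured_block d \<tau> 1)"
    "cond_entropy_ZE d \<sigma> = cond_ent (measured_block d \<sigma> 0) (measured_block d \<sigma> 1)"
    by (simp_all only: cond_entropy_ZE_eq)
  \<comment> \<open>With \<epsilon> = 4 Q (1 - Q), \<delta> is half of the continuity bound.\<close>
  have \<delta>: "\<delta> = (4 * Q * (1 - Q) + (1 + 4 * Q * (1 - Q)) * bin_entropy (4 * Q * (1 - Q) / (1 + 4 * Q * (1 - Q)))) / 2"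
    by (simp add: \<delta>_def field_simps)
  note bound = mixture_of_superpositions_bound[of x d y p q "4 * Q * (1 - Q)", OF c cross orth nrm nrm',
      folded \<kappa>_def, folded \<delta>]
  have two: "(0 :: nat) < 2" "(1 :: nat) < 2" by simp_all
  \<comment> \<open>Both bounds hold for every value of the entropy of \<tau>; the case distinction
    in \<open>fQ\<close> picks the larger one.\<close>
  have "cond_entropy_ZE d \<tau> / 2 \<le> cond_entropy_ZE d \<sigma>" "cond_entropy_ZE d \<tau> - \<delta> \<le> cond_entropy_ZE d \<sigma>"
    using bound
    unfolding ent tau[OF two(1)] tau[OF two(2)] sigma[OF two(1)] sigma[OF two(2)] by blast+
  then show ?thesis by (simp add: fQ_def)
qed

end
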